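(* In the setting described in the context, suppose: (i) (Occupancy coverage and temporal consistency) for every $t\ge t_0$, $s\in[0,T]$ and $j=1,\dots,M(t)$, $$\mathcal O^{(j)}(P(x(t)),t)\oplus \mathcal B(\bar v_{o}s+r_{\rm col})\subseteq \widehat{\mathcal H}^{(j)}(t,s),$$ and for every update interval $[t_k,t_{k+1})$, every $j$, and every $\delta\ge 0$ with $t,t+\delta\in[t_k,t_{k+1})$ and $s,s+\delta\in[0,T]$, $\widehat{\mathcal H}^{(j)}(t+\delta,s)\subseteq\widehat{\mathcal H}^{(j)}(t,s+\delta)$; (ii) (Verified terminal set) there is an extended class-$\mathcal K$ function $\alpha_S$ such that for every $q\ge t_0+T$, every $y\in\mathcal S_0(q)$ and every $j$, $$\frac{\partial h_j^S}{\partial q}(y,q)+\nabla_y h_j^S(y,q)^\top f_b(y)\ \ge\ -\alpha_S\big(h_j^S(y,q)\big),$$ and this $\alpha_S$ is the one used in the OCBF-QP; (iii) on each update interval the occupancy margins satisfy $\dfrac{\partial h_j^C}{\partial t}(y,t,s)-\dfrac{\partial h_j^C}{\partial s}(y,t,s)\ge 0$ for all $y\in\mathcal X$, $s\in[0,T]$ and all $j$; (iv) $f$, $g$, $P$, $\pi_b$, $h_j^C$, $h_j^S$ are continuously differentiable between updates, $\pi_b(x)\in\mathcal U$ for all $x\in\mathcal X$, and the backup flow $\varphi_b(x,\cdot)$ exists over $[0,T]$. Let $u$ be any piecewise locally Lipschitz control with values in $\mathcal U$ that satisfies the OCBF-QP constraints along the resulting robot trajectory and yields a forward-complete solution $x(t)$,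 $t\ge t_0$, of $\dot x=f(x)+g(x)u$. If $x(t_0)\in\mathcal S(t_0)$ and $x(t_k)\in\mathcal S(t_k^+)$ at every update time $t_k$, $k\ge1$, then for all $t\ge t_0$ and all $j=1,\dots,M(t)$, $$x(t)\in\mathcal S(t),\qquad h_j^C(x(t),t,0)\ge0 .$$ Consequently, the OCBF-QP is recursively feasible (it is feasible at $(x(t),t)$ for all $t\ge t_0$), and the robot avoids all hidden-obstacle motions covered by the occupancy prediction, i.e. $P(x(t))\notin\operatorname{int}\widehat{\mathcal H}^{(j)}(t,0)$ for all $t\ge t_0$ and all $j=1,\dots,M(t)$, where $\widehat{\mathcal H}^{(j)}(t,0)\supseteq\mathcal O^{(j)}(P(x(t)),t)\oplus\mathcal B(r_{\rm col})$.
   Context: **Robot.** $\dot x=f(x)+g(x)u$, $x\in\mathcal X\subseteq\mathbb R^n$, $u\in\mathcal U\subset\mathbb R^m$, with $\mathcal X,\mathcal U$ compact and convex and $f,g$ continuously differentiable and locally Lipschitz. All trajectories, including backup trajectories, take values in $\mathcal X$. $P:\mathcal X\to\mathcal W\subseteq\mathbb R^d$ is continuously differentiable and gives the workspace position of the robot. $u_{\rm nom}:\mathcal X\times\mathbb R_{\ge0}\to\mathcal U$ is a given nominal controller. Continuous differentiability on a non-open set means existence of a $C^1$ extension to a neighbourhood; time derivatives at interval endpoints are one-sided. **Constants and conventions.** Horizon $T>0$, obstacle speed bound $\bar v_o>0$, collision radius $r_{\rm col}\ge0$, terminal clearance $\rho_T\ge0$, matrix $W\succ0$, $\|v\|_W^2=v^\top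 Wv$. $\mathcal B(r)\subseteq\mathbb R^d$ is the closed Euclidean ball of radius $r$ centred at $0$, and $\oplus$ is the Minkowski sum. An extended class-$\mathcal K$ function is a continuous strictly increasing $\alpha:\mathbb R\to\mathbb R$ with $\alpha(0)=0$. $\alpha_C$ is a locally Lipschitz extended class-$\mathcal K$ function. **Updates.** $0\le t_0<t_1<\cdots$ are update times whose intervals $[t_k,t_{k+1})$ partition $[t_0,\infty)$. On each update interval the number of occluded regions $M=M(t)\ge1$, their indexing $j=1,\dots,M$, and the backup policy $\pi_b$ are fixed; all data may change discontinuously at the $t_k$. "Between updates" means within one such interval, and quantifiers over $j$ range over $j=1,\dots,M$. $\mathcal S(t_k^+)$ denotes the recoverable set (defined below) at time $t_k$ built from the post-update data, i.e. those of $[t_k,t_{k+1})$. The robot state is continuous in time across updates. **Occupancy.** $\mathcal O(P(x(t)),t)=\bigcup_{j=1}^{M(t)}\mathcal O^{(j)}(P(x(t)),t)\subseteq\mathcal W$ is the set of positions at which an undetected obstacle may be located at time $t$, where $x(t)$ is the realized robot state. $\widehat{\mathcal H}^{(j)}(t,s)\subseteq\mathbb R^d$, $s\in[0,T]$, are the predicted collision-inflated reachable-occupancy sets. The occupancy margins $h_j^C(y,t,s)\in\mathbb R$ ($y\in\mathcal X$, $s\in[0,T]$) satisfy: $h_j^C(y,t,s)\ge0\Rightarrow P(y)\notin\operatorname{int}\widehat{\mathcal H}^{(j)}(t,s)$. **Backup flow.** $\pi_b:\mathcal X\to\mathcal U$ is a state-feedback law, $f_b(x)=f(x)+g(x)\pi_b(x)$,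 and $\varphi_b(x,s)$ solves $\frac{d}{ds}\varphi_b(x,s)=f_b(\varphi_b(x,s))$, $\varphi_b(x,0)=x$. Its sensitivity is $\Phi_b(x,s)=\partial\varphi_b(x,s)/\partial x$. **Terminal barriers.** $h_j^S(y,q)\in\mathbb R$ ($y\in\mathcal X$) satisfy: $h_j^S(y,q)\ge0\Rightarrow h_j^C(y,q-T,T)\ge\rho_T$. The terminal set is $\mathcal S_0(q)=\{y\in\mathcal X: h_j^S(y,q)\ge0,\ j=1,\dots,M\}$. For argument $q$, the data ($M$, $\pi_b$, $f_b$, $h_j^C,h_j^S$) are those of the update interval containing $q-T$. Set $\eta_j(x,t)=h_j^S(\varphi_b(x,T),t+T)$. **Recoverable set.** $$\mathcal S(t)=\{x\in\mathcal X:\ h_j^C(\varphi_b(x,s),t,s)\ge0\ \ \forall s\in[0,T],\ \forall j;\ \ \eta_j(x,t)\ge0\ \ \forall j\}.$$ **OCBF-QP.** For $\tau\in[t,t+T]$ put $s=\tau-t$, $y=\varphi_b(x,s)$, $\xi_j^C(x,t;\tau)=h_j^C(y,t,s)$, and define $$A_j^C=(\nabla_yh_j^C)^\top\Phi_b(x,s)g(x),\qquad c_j^C=(\nabla_yh_j^C)^\top[\Phi_b(x,s)f(x)-f_b(y)]+\tfrac{\partial h_j^C}{\partial t}-\tfrac{\partial h_j^C}{\partial s},$$ with $h_j^C$ derivatives evaluated at $(y,t,s)$, and $$A_j^S=(\nabla_yh_j^S)^\top\Phi_b(x,T)g(x),\qquad c_j^S=(\nabla_yh_j^S)^\top\Phi_b(x,T)f(x)+\tfrac{\partial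 h_j^S}{\partial q},$$ with $h_j^S$ derivatives evaluated at $(\varphi_b(x,T),t+T)$. The OCBF-QP at $(x,t)$ is: minimize $\frac12\|u-u_{\rm nom}(x,t)\|_W^2$ over $u\in\mathcal U$ subject to $$c_j^C+A_j^Cu\ge-\alpha_C(\xi_j^C)\quad\forall j,\ \forall\tau\in[t,t+T],\qquad c_j^S+A_j^Su\ge-\alpha_S(\eta_j)\quad\forall j.$$ It is feasible at $(x,t)$ if some $u\in\mathcal U$ satisfies all these constraints. *)

theory Defs
  imports "HOL-Analysis.Analysis" "HOL-Library.Set_Algebras"
begin

section \<open>Regularity notions\<close>

text \<open>Continuous differentiability on a possibly non-open set: existence of a continuously
  differentiable extension to an open neighbourhood.\<close>

definition C1_on :: "'a::real_normed_vector set \<Rightarrow> ('a \<Rightarrow> 'b::real_normed_vector) \<Rightarrow> bool" where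
  "C1_on S F \<longleftrightarrow>
     (\<exists>N G. \<exists>G' :: 'a \<Rightarrow> 'a \<Rightarrow>\<^sub>L 'b. open N \<and> S \<subseteq> N \<and>
        (\<forall>z\<in>N. (G has_derivative blinfun_apply (G' z)) (at z)) \<and>
        continuous_on N G' \<and> (\<forall>z\<in>S. G z = F z))"

text \<open>The first argument of \<^const>\<open>local_lipschitz\<close> is a time set; a singleton makes it trivial.\<close>

definition locally_lipschitz :: "'a::metric_space set \<Rightarrow> ('a \<Rightarrow> 'b::metric_space) \<Rightarrow> bool" where
  "locally_lipschitz S F \<longleftrightarrow> local_lipschitz {0::real} S (\<lambda>_. F)"

definition ext_class_K :: "(real \<Rightarrow> real) \<Rightarrow> bool" where
  "ext_class_K \<alpha> \<longleftrightarrow> continuous_on UNIV \<alpha> \<and> strict_mono \<alpha> \<and> \<alpha> 0 = 0"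

definition pos_def :: "real^'m^'m \<Rightarrow> bool" where
  "pos_def A \<longleftrightarrow> transpose A = A \<and> (\<forall>v. v \<noteq> 0 \<longrightarrow> 0 < v \<bullet> (A *v v))"

text \<open>Gradient relative to a set. For a convex set with nonempty interior a \<open>C\<^sup>1\<close> function has
  exactly one derivative within the set at each of its points, which is the derivative of every
  \<open>C\<^sup>1\<close> extension. For a lower-dimensional convex set \<^const>\<open>frechet_derivative\<close> picks an
  unspecified one; all of them agree on the velocities of curves that stay in the set.\<close>

definition grad_within :: "(real^'n) set \<Rightarrow> (real^'n \<Rightarrow> real) \<Rightarrow> real^'n \<Rightarrow> real^'n" where
  "grad_within S F y = (\<chi> i. frechet_derivative F (at y within S) (axis i 1))"

section \<open>The data\<close>

text \<open>\<open>M\<close>, the backup policy and its flow are indexed by the number of the update interval on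
  which they are in force. The data depending on time are functions of absolute time that may jump
  at the update times. Occlusion indices \<open>j\<close> range over \<open>{1..M}\<close>.\<close>

record ('n::finite, 'm::finite, 'd::finite) ocbf =
  state_set :: "(real^'n) set"
  input_set :: "(real^'m) set"
  workspace :: "(real^'d) set"
  drift :: "real^'n \<Rightarrow> real^'n"
  actuation :: "real^'n \<Rightarrow> real^'m^'n"
  position :: "real^'n \<Rightarrow> real^'d"
  u_nom :: "real^'n \<Rightarrow> real \<Rightarrow> real^'m"
  horizon :: real
  obs_speed :: real
  col_radius :: real
  term_clearance :: real
  weight :: "real^'m^'m"
  alpha_C :: "real \<Rightarrow> real"
  upd_time :: "nat \<Rightarrow> real"
  num_occ :: "nat \<Rightarrow> nat"
  backup :: "nat \<Rightarrow> real^'n \<Rightarrow> real^'m"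
  backup_flow :: "nat \<Rightarrow> real^'n \<Rightarrow> real \<Rightarrow> real^'n"
  occ :: "nat \<Rightarrow> real^'d \<Rightarrow> real \<Rightarrow> (real^'d) set"
  occ_pred :: "nat \<Rightarrow> real \<Rightarrow> real \<Rightarrow> (real^'d) set"
  hC :: "nat \<Rightarrow> real^'n \<Rightarrow> real \<Rightarrow> real \<Rightarrow> real"
  hS :: "nat \<Rightarrow> real^'n \<Rightarrow> real \<Rightarrow> real"

definition t_init :: "('n::finite, 'm::finite, 'd::finite) ocbf \<Rightarrow> real" where
  "t_init R = upd_time R 0"

definition upd_interval :: "('n::finite, 'm::finite, 'd::finite) ocbf \<Rightarrow> nat \<Rightarrow> real set" where
  "upd_interval R k = {upd_time R k ..< upd_time R (Suc k)}"

definition upd_index :: "('n::finite, 'm::finite, 'd::finite) ocbf \<Rightarrow> real \<Rightarrow> nat" where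
  "upd_index R t = (THE k. t \<in> upd_interval R k)"

definition occ_indices :: "('n::finite, 'm::finite, 'd::finite) ocbf \<Rightarrow> real \<Rightarrow> nat set" where
  "occ_indices R t = {1..num_occ R (upd_index R t)}"

definition f_b :: "('n::finite, 'm::finite, 'd::finite) ocbf \<Rightarrow> nat \<Rightarrow> real^'n \<Rightarrow> real^'n" where
  "f_b R k x = drift R x + actuation R x *v backup R k x"

text \<open>The flow in force at time \<open>t\<close>, and its sensitivity.\<close>

definition phi_b :: "('n::finite, 'm::finite, 'd::finite) ocbf \<Rightarrow> real \<Rightarrow> real^'n \<Rightarrow> real \<Rightarrow> real^'n" where
  "phi_b R t x s = backup_flow R (upd_index R t) x s"

definition Phi_b :: "('n::finite, 'm::finite, 'd::finite) ocbf \<Rightarrow> real \<Rightarrow> real^'n \<Rightarrow> real \<Rightarrow> real^'n^'n" where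
  "Phi_b R t x s = jacobian (\<lambda>z. phi_b R t z s) (at x within state_set R)"

section \<open>Derivatives of the barriers\<close>

definition grad_hC :: "('n::finite, 'm::finite, 'd::finite) ocbf \<Rightarrow> nat \<Rightarrow> real^'n \<Rightarrow> real \<Rightarrow> real \<Rightarrow> real^'n" where
  "grad_hC R j y t s = grad_within (state_set R) (\<lambda>z. hC R j z t s) y"

definition dt_hC :: "('n::finite, 'm::finite, 'd::finite) ocbf \<Rightarrow> nat \<Rightarrow> real^'n \<Rightarrow> real \<Rightarrow> real \<Rightarrow> real" where
  "dt_hC R j y t s =
     vector_derivative (\<lambda>t'. hC R j y t' s) (at t within upd_interval R (upd_index R t))"

definition ds_hC :: "('n::finite, 'm::finite, 'd::finite) ocbf \<Rightarrow> nat \<Rightarrow> real^'n \<Rightarrow> real \<Rightarrow> real \<Rightarrow> real" where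
  "ds_hC R j y t s = vector_derivative (\<lambda>s'. hC R j y t s') (at s within {0..horizon R})"

text \<open>For \<open>hS\<close> the interval in force at argument \<open>q\<close> is the one containing \<open>q - T\<close>.\<close>

definition term_interval :: "('n::finite, 'm::finite, 'd::finite) ocbf \<Rightarrow> nat \<Rightarrow> real set" where
  "term_interval R k = {q. q - horizon R \<in> upd_interval R k}"

definition grad_hS :: "('n::finite, 'm::finite, 'd::finite) ocbf \<Rightarrow> nat \<Rightarrow> real^'n \<Rightarrow> real \<Rightarrow> real^'n" where
  "grad_hS R j y q = grad_within (state_set R) (\<lambda>z. hS R j z q) y"

definition dq_hS :: "('n::finite, 'm::finite, 'd::finite) ocbf \<Rightarrow> nat \<Rightarrow> real^'n \<Rightarrow> real \<Rightarrow> real" where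
  "dq_hS R j y q =
     vector_derivative (\<lambda>q'. hS R j y q')
       (at q within term_interval R (upd_index R (q - horizon R)))"

section \<open>Terminal and recoverable sets\<close>

definition term_set :: "('n::finite, 'm::finite, 'd::finite) ocbf \<Rightarrow> real \<Rightarrow> (real^'n) set" where
  "term_set R q = {y \<in> state_set R. \<forall>j\<in>occ_indices R (q - horizon R). hS R j y q \<ge> 0}"

definition eta :: "('n::finite, 'm::finite, 'd::finite) ocbf \<Rightarrow> nat \<Rightarrow> real^'n \<Rightarrow> real \<Rightarrow> real" where
  "eta R j x t = hS R j (phi_b R t x (horizon R)) (t + horizon R)"

text \<open>Since update intervals are closed on the left, at an update time this set is built from the
  post-update data.\<close>

definition recoverable :: "('n::finite, 'm::finite, 'd::finite) ocbf \<Rightarrow> real \<Rightarrow> (real^'n) set" where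
  "recoverable R t = {x \<in> state_set R.
     (\<forall>s\<in>{0..horizon R}. \<forall>j\<in>occ_indices R t. hC R j (phi_b R t x s) t s \<ge> 0) \<and>
     (\<forall>j\<in>occ_indices R t. eta R j x t \<ge> 0)}"

section \<open>The OCBF-QP\<close>

definition xi_C :: "('n::finite, 'm::finite, 'd::finite) ocbf \<Rightarrow> nat \<Rightarrow> real^'n \<Rightarrow> real \<Rightarrow> real \<Rightarrow> real" where
  "xi_C R j x t \<tau> = hC R j (phi_b R t x (\<tau> - t)) t (\<tau> - t)"

definition A_C :: "('n::finite, 'm::finite, 'd::finite) ocbf \<Rightarrow> nat \<Rightarrow> real^'n \<Rightarrow> real \<Rightarrow> real \<Rightarrow> real^'m" where
  "A_C R j x t \<tau> = (let s = \<tau> - t; y = phi_b R t x s in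
     grad_hC R j y t s v* (Phi_b R t x s ** actuation R x))"

definition c_C :: "('n::finite, 'm::finite, 'd::finite) ocbf \<Rightarrow> nat \<Rightarrow> real^'n \<Rightarrow> real \<Rightarrow> real \<Rightarrow> real" where
  "c_C R j x t \<tau> = (let s = \<tau> - t; y = phi_b R t x s in
     grad_hC R j y t s \<bullet> (Phi_b R t x s *v drift R x - f_b R (upd_index R t) y)
       + dt_hC R j y t s - ds_hC R j y t s)"

definition A_S :: "('n::finite, 'm::finite, 'd::finite) ocbf \<Rightarrow> nat \<Rightarrow> real^'n \<Rightarrow> real \<Rightarrow> real^'m" where
  "A_S R j x t = (let T = horizon R; y = phi_b R t x T in
     grad_hS R j y (t + T) v* (Phi_b R t x T ** actuation R x))"

definition c_S :: "('n::finite, 'm::finite, 'd::finite) ocbf \<Rightarrow> nat \<Rightarrow> real^'n \<Rightarrow> real \<Rightarrow> real" where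
  "c_S R j x t = (let T = horizon R; y = phi_b R t x T in
     grad_hS R j y (t + T) \<bullet> (Phi_b R t x T *v drift R x) + dq_hS R j y (t + T))"

definition qp_cost :: "('n::finite, 'm::finite, 'd::finite) ocbf \<Rightarrow> real^'n \<Rightarrow> real \<Rightarrow> real^'m \<Rightarrow> real" where
  "qp_cost R x t u = (u - u_nom R x t) \<bullet> (weight R *v (u - u_nom R x t)) / 2"

definition qp_constraints ::
  "('n::finite, 'm::finite, 'd::finite) ocbf \<Rightarrow> (real \<Rightarrow> real) \<Rightarrow> real^'n \<Rightarrow> real \<Rightarrow> real^'m \<Rightarrow> bool" where
  "qp_constraints R \<alpha>S x t u \<longleftrightarrow>
     (\<forall>j\<in>occ_indices R t. \<forall>\<tau>\<in>{t..t + horizon R}.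
        c_C R j x t \<tau> + A_C R j x t \<tau> \<bullet> u \<ge> - alpha_C R (xi_C R j x t \<tau>)) \<and>
     (\<forall>j\<in>occ_indices R t. c_S R j x t + A_S R j x t \<bullet> u \<ge> - \<alpha>S (eta R j x t))"

definition qp_feasible ::
  "('n::finite, 'm::finite, 'd::finite) ocbf \<Rightarrow> (real \<Rightarrow> real) \<Rightarrow> real^'n \<Rightarrow> real \<Rightarrow> bool" where
  "qp_feasible R \<alpha>S x t \<longleftrightarrow> (\<exists>u\<in>input_set R. qp_constraints R \<alpha>S x t u)"

definition qp_solution ::
  "('n::finite, 'm::finite, 'd::finite) ocbf \<Rightarrow> (real \<Rightarrow> real) \<Rightarrow> real^'n \<Rightarrow> real \<Rightarrow> real^'m \<Rightarrow> bool" where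
  "qp_solution R \<alpha>S x t u \<longleftrightarrow>
     is_arg_min (qp_cost R x t) (\<lambda>v. v \<in> input_set R \<and> qp_constraints R \<alpha>S x t v) u"

section \<open>Standing assumptions\<close>

definition ocbf_setting :: "('n::finite, 'm::finite, 'd::finite) ocbf \<Rightarrow> bool" where
  "ocbf_setting R \<longleftrightarrow>
     compact (state_set R) \<and> convex (state_set R) \<and>
     compact (input_set R) \<and> convex (input_set R) \<and>
     C1_on (state_set R) (drift R) \<and> locally_lipschitz (state_set R) (drift R) \<and>
     C1_on (state_set R) (actuation R) \<and> locally_lipschitz (state_set R) (actuation R) \<and>
     C1_on (state_set R) (position R) \<and> position R ` state_set R \<subseteq> workspace R \<and>
     (\<forall>x\<in>state_set R. \<forall>t\<ge>0. u_nom R x t \<in> input_set R) \<and>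
     horizon R > 0 \<and> obs_speed R > 0 \<and> col_radius R \<ge> 0 \<and> term_clearance R \<ge> 0 \<and>
     pos_def (weight R) \<and>
     ext_class_K (alpha_C R) \<and> locally_lipschitz UNIV (alpha_C R) \<and>
     upd_time R 0 \<ge> 0 \<and> strict_mono (upd_time R) \<and>
     (\<Union>k. upd_interval R k) = {t_init R..} \<and>
     (\<forall>k. num_occ R k \<ge> 1) \<and>
     (\<forall>t\<ge>t_init R. \<forall>j\<in>occ_indices R t. \<forall>y\<in>state_set R. \<forall>s\<in>{0..horizon R}.
        hC R j y t s \<ge> 0 \<longrightarrow> position R y \<notin> interior (occ_pred R j t s)) \<and>
     (\<forall>q\<ge>t_init R + horizon R. \<forall>j\<in>occ_indices R (q - horizon R). \<forall>y\<in>state_set R.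
        hS R j y q \<ge> 0 \<longrightarrow> hC R j y (q - horizon R) (horizon R) \<ge> term_clearance R)"

text \<open>The backup flow exists over the whole horizon from every state and stays in the state set.\<close>

definition is_backup_flow :: "('n::finite, 'm::finite, 'd::finite) ocbf \<Rightarrow> nat \<Rightarrow> bool" where
  "is_backup_flow R k \<longleftrightarrow>
     (\<forall>x\<in>state_set R. backup_flow R k x 0 = x \<and>
        (\<forall>s\<in>{0..horizon R}. backup_flow R k x s \<in> state_set R \<and>
           (backup_flow R k x has_vector_derivative f_b R k (backup_flow R k x s))
             (at s within {0..horizon R})))"

text \<open>A control (feedback in the state and explicit in time) that is locally Lipschitz off a locally
  finite set \<open>D\<close> of switching instants. The open-loop signals are the special case of a control
  that does not depend on the state.\<close>

definition piecewise_lipschitz_control ::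
  "('n::finite, 'm::finite, 'd::finite) ocbf \<Rightarrow> real set \<Rightarrow> (real^'n \<Rightarrow> real \<Rightarrow> real^'m) \<Rightarrow> bool" where
  "piecewise_lipschitz_control R D u \<longleftrightarrow>
     (\<forall>b. finite (D \<inter> {t_init R..b})) \<and>
     locally_lipschitz (state_set R \<times> ({t_init R..} - D)) (\<lambda>(y, t). u y t) \<and>
     (\<forall>y\<in>state_set R. \<forall>t\<ge>t_init R. u y t \<in> input_set R)"

text \<open>A forward-complete solution: continuous, with values in the state set, satisfying the
  differential equation at every time that is not a switching instant.\<close>

definition robot_trajectory ::
  "('n::finite, 'm::finite, 'd::finite) ocbf \<Rightarrow> real set \<Rightarrow> (real^'n \<Rightarrow> real \<Rightarrow> real^'m) \<Rightarrow>
   (real \<Rightarrow> real^'n) \<Rightarrow> bool" where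
  "robot_trajectory R D u x \<longleftrightarrow>
     continuous_on {t_init R..} x \<and>
     (\<forall>t\<ge>t_init R. x t \<in> state_set R) \<and>
     (\<forall>t\<in>{t_init R..} - D.
        (x has_vector_derivative (drift R (x t) + actuation R (x t) *v u (x t) t))
          (at t within {t_init R..}))"

end

theory Submission
  imports Defs
begin

text \<open>For fixed \<open>\<tau>\<close>, the left-hand side of a margin constraint is the time derivative of
  \<open>r \<mapsto> h\<^sub>C(\<phi>(x r, \<tau> - r), r, \<tau> - r)\<close> along the trajectory, and that of a terminal constraint is the
  derivative of \<open>\<eta>\<close>; hence both stay nonnegative between updates. The chain rule needs the backup flow
  to be differentiable in the initial state within the state set. At the backup input \<open>\<Phi>\<close> maps
  \<open>f\<^sub>b(x)\<close> to \<open>f\<^sub>b(\<phi>(x, s))\<close>, so the constraints reduce to hypotheses (ii) and (iii), which gives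
  feasibility.\<close>

section \<open>Linear growth estimates\<close>

lemma norm_squared_linear_growth:
  fixes w :: "real \<Rightarrow> 'a::real_inner"
  assumes deriv: "\<And>s. s \<in> {0..T} \<Longrightarrow> (w has_vector_derivative w' s) (at s within {0..T})"
    and growth: "\<And>s. s \<in> {0..T} \<Longrightarrow> norm (w' s) \<le> K * norm (w s) + d"
    and K: "0 \<le> K" and s: "s \<in> {0..T}"
  shows "(norm (w s))\<^sup>2 \<le> exp ((2 * K + 1) * s) * ((norm (w 0))\<^sup>2 + d\<^sup>2 * s)"
proof -
  define L where "L = 2 * K + 1"
  define E where "E r = exp (- L * r) * (w r \<bullet> w r) - d\<^sup>2 * r" for r
  have E': "(E has_real_derivative
      exp (- L * r) * (2 * (w r \<bullet> w' r)) - L * exp (- L * r) * (w r \<bullet> w r) - d\<^sup>2) (at r within {0..T})"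
    if r: "r \<in> {0..T}" for r
  proof -
    have eq: "(\<lambda>h. w r \<bullet> h *\<^sub>R w' r + h *\<^sub>R w' r \<bullet> w r) = (*) (2 * (w r \<bullet> w' r))"
      by (auto simp: fun_eq_iff inner_commute[of "w' r"])
    have "((\<lambda>r. w r \<bullet> w r) has_real_derivative 2 * (w r \<bullet> w' r)) (at r within {0..T})"
      using has_derivative_inner[OF deriv[OF r, unfolded has_vector_derivative_def]
          deriv[OF r, unfolded has_vector_derivative_def]]
      unfolding eq has_field_derivative_def .
    then show ?thesis
      unfolding E_def by (auto intro!: derivative_eq_intros simp: algebra_simps)
  qed
  have neg: "exp (- L * r) * (2 * (w r \<bullet> w' r)) - L * exp (- L * r) * (w r \<bullet> w r) - d\<^sup>2 \<le> 0"
    if r: "r \<in> {0..T}" for r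
  proof -
    have "w r \<bullet> w' r \<le> norm (w r) * norm (w' r)"
      by (rule norm_cauchy_schwarz)
    also have "\<dots> \<le> norm (w r) * (K * norm (w r) + d)"
      by (intro mult_left_mono growth r) simp
    finally have "2 * (w r \<bullet> w' r) \<le> 2 * K * (norm (w r))\<^sup>2 + 2 * norm (w r) * d"
      by (simp add: algebra_simps power2_eq_square)
    moreover have "2 * norm (w r) * d \<le> (norm (w r))\<^sup>2 + d\<^sup>2"
      by (rule sum_squares_bound)
    ultimately have 1: "2 * (w r \<bullet> w' r) - L * (w r \<bullet> w r) \<le> d\<^sup>2"
      unfolding L_def by (simp add: power2_norm_eq_inner[symmetric] algebra_simps)
    have "exp (- L * r) * (2 * (w r \<bullet> w' r) - L * (w r \<bullet> w r)) \<le> exp (- L * r) * d\<^sup>2"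
      by (intro mult_left_mono 1) simp
    also have "\<dots> \<le> 1 * d\<^sup>2"
      using K r unfolding L_def by (intro mult_right_mono) (auto intro: mult_nonpos_nonneg)
    finally show ?thesis
      by (simp add: algebra_simps)
  qed
  have "E s \<le> E 0"
  proof (rule DERIV_nonpos_imp_decreasing_open[where f = E])
    show "0 \<le> s" using s by simp
    show "\<exists>y. DERIV E r :> y \<and> y \<le> 0" if "0 < r" "r < s" for r
    proof -
      have r: "r \<in> {0..T}" and at: "at r within {0..T} = at r"
        using that s by (auto simp: at_within_Icc_at)
      show ?thesis
        using E'[OF r, unfolded at] neg[OF r] by blast
    qed
    show "continuous_on {0..s} E"
      by (rule continuous_on_subset[OF DERIV_continuous_on[OF E']]) (use s in auto)
  qed
  then have "exp (- L * s) * (norm (w s))\<^sup>2 \<le> (norm (w 0))\<^sup>2 + d\<^sup>2 * s"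
    by (simp add: E_def power2_norm_eq_inner)
  then have "exp (L * s) * (exp (- L * s) * (norm (w s))\<^sup>2)
      \<le> exp (L * s) * ((norm (w 0))\<^sup>2 + d\<^sup>2 * s)"
    by (rule mult_left_mono) simp
  moreover have "exp (L * s) * exp (- L * s) = 1"
    by (simp add: exp_minus)
  ultimately show ?thesis
    by (simp only: L_def[symmetric] mult.assoc[symmetric] mult_1_left)
qed

lemma norm_linear_growth:
  fixes w :: "real \<Rightarrow> 'a::real_inner"
  assumes deriv: "\<And>s. s \<in> {0..T} \<Longrightarrow> (w has_vector_derivative w' s) (at s within {0..T})"
    and growth: "\<And>s. s \<in> {0..T} \<Longrightarrow> norm (w' s) \<le> K * norm (w s)"
    and K: "0 \<le> K" and s: "s \<in> {0..T}"
  shows "norm (w s) \<le> exp ((2 * K + 1) * T) * norm (w 0)"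
proof -
  have "(norm (w s))\<^sup>2 \<le> exp ((2 * K + 1) * s) * (norm (w 0))\<^sup>2"
    using norm_squared_linear_growth[OF deriv _ K s, where d = 0] growth by simp
  also have "\<dots> \<le> exp ((2 * K + 1) * T) * (norm (w 0))\<^sup>2"
    using s K by (intro mult_right_mono) (auto intro: mult_left_mono)
  also have "\<dots> \<le> (exp ((2 * K + 1) * T))\<^sup>2 * (norm (w 0))\<^sup>2"
    using K s by (intro mult_right_mono) (auto simp: power2_eq_square)
  finally show ?thesis
    by (rule power2_le_imp_le[OF _ mult_nonneg_nonneg, unfolded power_mult_distrib]) auto
qed

section \<open>Linear differential equations\<close>

primrec peano_baker :: "(real \<Rightarrow> 'a::real_normed_vector \<Rightarrow>\<^sub>L 'a) \<Rightarrow> nat \<Rightarrow> real \<Rightarrow> 'a \<Rightarrow>\<^sub>L 'a" where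
  "peano_baker A 0 = (\<lambda>s. id_blinfun)"
| "peano_baker A (Suc n) = (\<lambda>s. integral {0..s} (\<lambda>r. A r o\<^sub>L peano_baker A n r))"

lemma continuous_on_peano_baker:
  fixes A :: "real \<Rightarrow> 'a::banach \<Rightarrow>\<^sub>L 'a"
  assumes A: "continuous_on {0..T} A"
  shows "continuous_on {0..T} (peano_baker A n)"
proof (induction n)
  case (Suc n)
  have "continuous_on {0..T} (\<lambda>s. integral {0..s} (\<lambda>r. A r o\<^sub>L peano_baker A n r))"
    by (intro indefinite_integral_continuous_1 integrable_continuous_real continuous_intros A Suc)
  then show ?case by simp
qed simp

lemma peano_baker_derivative:
  fixes A :: "real \<Rightarrow> 'a::banach \<Rightarrow>\<^sub>L 'a"
  assumes A: "continuous_on {0..T} A" and s: "s \<in> {0..T}"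
  shows "(peano_baker A (Suc n) has_vector_derivative A s o\<^sub>L peano_baker A n s) (at s within {0..T})"
proof -
  have "((\<lambda>s. integral {0..s} (\<lambda>r. A r o\<^sub>L peano_baker A n r))
     has_vector_derivative A s o\<^sub>L peano_baker A n s) (at s within {0..T})"
    by (intro integral_has_vector_derivative s continuous_intros A continuous_on_peano_baker)
  then show ?thesis by simp
qed

lemma norm_peano_baker_le:
  fixes A :: "real \<Rightarrow> 'a::banach \<Rightarrow>\<^sub>L 'a"
  assumes A: "continuous_on {0..T} A" and K: "\<And>s. s \<in> {0..T} \<Longrightarrow> norm (A s) \<le> K"
    and s: "s \<in> {0..T}"
  shows "norm (peano_baker A n s) \<le> (K * s) ^ n / fact n"
  using s
proof (induction n arbitrary: s)
  case 0
  show ?case by (simp add: norm_blinfun_id_le)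
next
  case (Suc n)
  have K0: "0 \<le> K" using K[OF Suc.prems] norm_ge_zero order_trans by blast
  have sub: "{0..s} \<subseteq> {0..T}" using Suc.prems by auto
  have "((\<lambda>r. K * ((K * r) ^ n / fact n)) has_integral
      (K * s) ^ Suc n / fact (Suc n) - (K * 0) ^ Suc n / fact (Suc n)) {0..s}"
  proof (rule fundamental_theorem_of_calculus)
    fix r assume "r \<in> {0..s}"
    have "((\<lambda>r. (K * r) ^ Suc n / fact (Suc n)) has_real_derivative
        real (Suc n) * (K * r) ^ n * K / fact (Suc n)) (at r within {0..s})"
      by (rule derivative_eq_intros refl | simp)+
    moreover have "real (Suc n) * (K * r) ^ n * K / fact (Suc n) = K * ((K * r) ^ n / fact n)"
      by (simp add: field_simps del: of_nat_Suc)
    ultimately show "((\<lambda>r. (K * r) ^ Suc n / fact (Suc n)) has_vector_derivative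
        K * ((K * r) ^ n / fact n)) (at r within {0..s})"
      by (simp only: has_real_derivative_iff_has_vector_derivative)
  qed (use Suc.prems in auto)
  then have int: "((\<lambda>r. K * ((K * r) ^ n / fact n)) has_integral (K * s) ^ Suc n / fact (Suc n)) {0..s}"
    by simp
  have "norm (integral {0..s} (\<lambda>r. A r o\<^sub>L peano_baker A n r))
      \<le> integral {0..s} (\<lambda>r. K * ((K * r) ^ n / fact n))"
  proof (rule integral_norm_bound_integral)
    show "(\<lambda>r. A r o\<^sub>L peano_baker A n r) integrable_on {0..s}"
      by (intro integrable_continuous_real continuous_intros
          continuous_on_subset[OF A sub] continuous_on_subset[OF continuous_on_peano_baker[OF A] sub])
    show "(\<lambda>r. K * ((K * r) ^ n / fact n)) integrable_on {0..s}"
      using int by blast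
    show "norm (A r o\<^sub>L peano_baker A n r) \<le> K * ((K * r) ^ n / fact n)" if "r \<in> {0..s}" for r
    proof -
      have r: "r \<in> {0..T}" using that sub by auto
      have "norm (A r o\<^sub>L peano_baker A n r) \<le> norm (A r) * norm (peano_baker A n r)"
        by (rule norm_blinfun_compose)
      also have "\<dots> \<le> K * ((K * r) ^ n / fact n)"
        by (intro mult_mono K Suc.IH r K0) auto
      finally show ?thesis .
    qed
  qed
  also have "\<dots> = (K * s) ^ Suc n / fact (Suc n)"
    using int by (rule integral_unique)
  finally show ?case by simp
qed

lemma linear_ode_fundamental_solution:
  fixes A :: "real \<Rightarrow> 'a::banach \<Rightarrow>\<^sub>L 'a"
  assumes A: "continuous_on {0..T} A" and T: "0 \<le> T"
  obtains Y where "Y 0 = id_blinfun"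
    "\<And>s. s \<in> {0..T} \<Longrightarrow> (Y has_vector_derivative A s o\<^sub>L Y s) (at s within {0..T})"
proof -
  have "bounded (A ` {0..T})"
    by (intro compact_imp_bounded compact_continuous_image A compact_Icc)
  then obtain K where K0: "0 < K" and "\<forall>x\<in>A ` {0..T}. norm x \<le> K"
    using bounded_pos by metis
  then have K: "norm (A s) \<le> K" if "s \<in> {0..T}" for s
    using that by blast
  define Y where "Y s = (\<Sum>n. peano_baker A n s)" for s
  define M where "M n = (K * T) ^ n / fact n" for n
  have summM: "summable M"
    unfolding M_def using summable_exp_generic[of "K * T"]
    by (simp add: field_simps scaleR_conv_of_real)
  have bound: "norm (peano_baker A n s) \<le> M n" if s: "s \<in> {0..T}" for n s
  proof -
    have "norm (peano_baker A n s) \<le> (K * s) ^ n / fact n"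
      by (rule norm_peano_baker_le[OF A K s])
    also have "\<dots> \<le> M n"
      unfolding M_def using s K0 by (intro divide_right_mono power_mono) auto
    finally show ?thesis .
  qed
  have unif: "uniform_limit {0..T} (\<lambda>n s. \<Sum>i<n. peano_baker A i s) Y sequentially"
    unfolding Y_def by (rule Weierstrass_m_test[OF bound summM])
  have sums: "(\<lambda>n. peano_baker A n s) sums Y s" if "s \<in> {0..T}" for s
    unfolding Y_def by (intro summable_sums summable_comparison_test'[OF summM, of 0] bound that)
  define D where "D n s = (case n of 0 \<Rightarrow> 0 | Suc m \<Rightarrow> A s o\<^sub>L peano_baker A m s)" for n s
  have D: "(peano_baker A n has_vector_derivative D n s) (at s within {0..T})" if "s \<in> {0..T}" for n s
    using peano_baker_derivative[OF A that] by (cases n) (auto simp: D_def[abs_def])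
  have sumD: "(\<Sum>i<Suc n. D i s) = A s o\<^sub>L (\<Sum>i<n. peano_baker A i s)" for n s
    by (subst sum.lessThan_Suc_shift)
      (simp add: D_def bounded_bilinear.sum_right[OF bounded_bilinear_blinfun_compose])
  have "\<exists>g. \<forall>s\<in>{0..T}. (\<lambda>n. peano_baker A n s) sums g s \<and>
      (g has_derivative (\<lambda>h. h *\<^sub>R (A s o\<^sub>L Y s))) (at s within {0..T})"
  proof (rule has_derivative_series)
    show "convex {0..T}" by (rule convex_real_interval)
    show "(peano_baker A n has_derivative (\<lambda>h. h *\<^sub>R D n s)) (at s within {0..T})"
      if "s \<in> {0..T}" for n s
      using D[OF that] by (simp add: has_vector_derivative_def)
    show "0 \<in> {0..T}" using T by simp
    then show "(\<lambda>n. peano_baker A n 0) sums Y 0" by (rule sums)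
    fix e :: real assume e: "0 < e"
    then have "\<forall>\<^sub>F n in sequentially. \<forall>s\<in>{0..T}. dist (\<Sum>i<n. peano_baker A i s) (Y s) < e / K"
      using K0 by (intro uniform_limitD[OF unif]) auto
    then have "\<forall>\<^sub>F n in sequentially. \<forall>s\<in>{0..T}. \<forall>h.
        norm ((\<Sum>i<Suc n. h *\<^sub>R D i s) - h *\<^sub>R (A s o\<^sub>L Y s)) \<le> e * norm h"
    proof eventually_elim
      case (elim n)
      show ?case
      proof (intro ballI allI)
        fix s h assume s: "s \<in> {0..T}"
        have "(\<Sum>i<Suc n. h *\<^sub>R D i s) - h *\<^sub>R (A s o\<^sub>L Y s)
            = h *\<^sub>R (A s o\<^sub>L ((\<Sum>i<n. peano_baker A i s) - Y s))"
          by (simp only: scaleR_sum_right[symmetric] sumD scaleR_diff_right[symmetric]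
              bounded_bilinear.diff_right[OF bounded_bilinear_blinfun_compose])
        then have "norm ((\<Sum>i<Suc n. h *\<^sub>R D i s) - h *\<^sub>R (A s o\<^sub>L Y s))
            = \<bar>h\<bar> * norm (A s o\<^sub>L ((\<Sum>i<n. peano_baker A i s) - Y s))"
          by simp
        also have "\<dots> \<le> \<bar>h\<bar> * (norm (A s) * norm ((\<Sum>i<n. peano_baker A i s) - Y s))"
          by (intro mult_left_mono norm_blinfun_compose) auto
        also have "\<dots> \<le> \<bar>h\<bar> * (K * (e / K))"
          using elim s K[OF s] K0
          by (intro mult_left_mono mult_mono) (auto simp: dist_norm less_imp_le)
        finally show "norm ((\<Sum>i<Suc n. h *\<^sub>R D i s) - h *\<^sub>R (A s o\<^sub>L Y s)) \<le> e * norm h"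
          using K0 by (simp add: mult.commute)
      qed
    qed
    then show "\<forall>\<^sub>F n in sequentially. \<forall>s\<in>{0..T}. \<forall>h.
        norm ((\<Sum>i<n. h *\<^sub>R D i s) - h *\<^sub>R (A s o\<^sub>L Y s)) \<le> e * norm h"
      by (subst (asm) eventually_sequentially_Suc)
  qed
  then obtain g where g: "\<And>s. s \<in> {0..T} \<Longrightarrow> (\<lambda>n. peano_baker A n s) sums g s"
    "\<And>s. s \<in> {0..T} \<Longrightarrow> (g has_vector_derivative A s o\<^sub>L Y s) (at s within {0..T})"
    unfolding has_vector_derivative_def by blast
  have gY: "g s = Y s" if "s \<in> {0..T}" for s
    using g(1)[OF that] sums[OF that] by (rule sums_unique2)
  have "peano_baker A n 0 = 0" if "n \<noteq> 0" for n
    using that by (cases n) auto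
  then have "(\<lambda>n. peano_baker A n 0) sums (\<Sum>n\<in>{0::nat}. peano_baker A n 0)"
    by (intro sums_finite) auto
  then have "g 0 = id_blinfun"
    using g(1)[of 0] T sums_unique2 by fastforce
  then show thesis
    using that[of g] g(2) gY by simp
qed

section \<open>Continuously differentiable functions on compact convex sets\<close>

lemma C1_on_derivative:
  assumes "C1_on S F"
  obtains F' where "\<And>z. z \<in> S \<Longrightarrow> (F has_derivative blinfun_apply (F' z)) (at z within S)"
    "continuous_on S F'"
proof -
  obtain N G G' where *: "open N" "S \<subseteq> N" "\<And>z. z \<in> N \<Longrightarrow> (G has_derivative blinfun_apply (G' z)) (at z)"
    "continuous_on N G'" "\<And>z. z \<in> S \<Longrightarrow> G z = F z"
    using assms unfolding C1_on_def by blast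
  show thesis
  proof (rule that[of G'])
    show "continuous_on S G'" using * continuous_on_subset by blast
    fix z assume z: "z \<in> S"
    have "(G has_derivative blinfun_apply (G' z)) (at z within S)"
      by (rule has_derivative_at_withinI[OF *(3)]) (use *(2) z in auto)
    from has_derivative_transform[OF z _ this]
    show "(F has_derivative blinfun_apply (G' z)) (at z within S)"
      by (simp add: *(5))
  qed
qed

lemma C1_on_imp_continuous_on:
  assumes "C1_on S F"
  shows "continuous_on S F"
  by (rule C1_on_derivative[OF assms]) (rule has_derivative_continuous_on)

lemma continuous_derivative_imp_lipschitz:
  assumes "compact S" "convex S"
    and F': "\<And>z. z \<in> S \<Longrightarrow> (F has_derivative blinfun_apply (F' z)) (at z within S)"
    and cont: "continuous_on S F'"
  obtains K where "0 \<le> K" "\<And>z. z \<in> S \<Longrightarrow> norm (F' z) \<le> K"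
    "\<And>y z. y \<in> S \<Longrightarrow> z \<in> S \<Longrightarrow> norm (F y - F z) \<le> K * norm (y - z)"
proof -
  have "bounded (F' ` S)"
    by (intro compact_imp_bounded compact_continuous_image assms)
  then obtain K where K0: "0 < K" and "\<forall>x\<in>F' ` S. norm x \<le> K"
    using bounded_pos by metis
  then have K: "norm (F' s) \<le> K" if "s \<in> S" for s
    using that by blast
  have "norm (F y - F z) \<le> K * norm (y - z)" if "y \<in> S" "z \<in> S" for y z
    by (rule differentiable_bound[OF \<open>convex S\<close> F' _ that])
      (use K in \<open>auto simp: norm_blinfun.rep_eq\<close>)
  then show thesis using that[of K] K0 K by auto
qed

lemma continuous_derivative_imp_uniformly_differentiable:
  assumes "compact S" "convex S"
    and F': "\<And>z. z \<in> S \<Longrightarrow> (F has_derivative blinfun_apply (F' z)) (at z within S)"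
    and cont: "continuous_on S F'" and e: "0 < e"
  obtains d where "0 < d" "\<And>y z. y \<in> S \<Longrightarrow> z \<in> S \<Longrightarrow> norm (z - y) < d \<Longrightarrow>
    norm (F z - F y - F' y (z - y)) \<le> e * norm (z - y)"
proof -
  have "uniformly_continuous_on S F'"
    by (intro compact_uniformly_continuous assms)
  then obtain d where d: "0 < d" "\<And>y z. y \<in> S \<Longrightarrow> z \<in> S \<Longrightarrow> dist z y < d \<Longrightarrow> dist (F' z) (F' y) < e"
    using e unfolding uniformly_continuous_on_def by metis
  show thesis
  proof (rule that[OF d(1)])
    fix y z assume yz: "y \<in> S" "z \<in> S" "norm (z - y) < d"
    have seg: "closed_segment y z \<subseteq> S"
      using yz \<open>convex S\<close> by (simp add: closed_segment_subset)
    have "norm (F z - F y - F' y (z - y)) \<le> norm (z - y) * e"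
    proof (rule differentiable_bound_linearization[where S = "closed_segment y z"])
      show "y + t *\<^sub>R (z - y) \<in> closed_segment y z" if "t \<in> {0..1}" for t
        using that by (auto simp: in_segment algebra_simps intro!: exI[of _ t])
      fix p assume p: "p \<in> closed_segment y z"
      then have "p \<in> S" using seg by auto
      then show "(F has_derivative blinfun_apply (F' p)) (at p within closed_segment y z)"
        using F' seg has_derivative_subset by blast
      have "dist p y \<le> dist z y"
        using segment_bound1[OF p] by (simp add: dist_norm norm_minus_commute)
      then have "norm (F' p - F' y) \<le> e"
        using d(2)[OF yz(1) \<open>p \<in> S\<close>] yz(3) by (simp add: dist_norm)
      then show "onorm (blinfun_apply (F' p) - blinfun_apply (F' y)) \<le> e"
        by (simp add: norm_blinfun.rep_eq minus_blinfun.rep_eq fun_diff_def)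
    qed simp
    then show "norm (F z - F y - F' y (z - y)) \<le> e * norm (z - y)"
      by (simp add: mult.commute)
  qed
qed

lemma C1_on_add:
  assumes "C1_on S F" "C1_on S H"
  shows "C1_on S (\<lambda>z. F z + H z)"
proof -
  obtain M G G' where G: "open M" "S \<subseteq> M" "\<And>z. z \<in> M \<Longrightarrow> (G has_derivative blinfun_apply (G' z)) (at z)"
    "continuous_on M G'" "\<And>z. z \<in> S \<Longrightarrow> G z = F z"
    using assms(1) unfolding C1_on_def by blast
  obtain N J J' where J: "open N" "S \<subseteq> N" "\<And>z. z \<in> N \<Longrightarrow> (J has_derivative blinfun_apply (J' z)) (at z)"
    "continuous_on N J'" "\<And>z. z \<in> S \<Longrightarrow> J z = H z"
    using assms(2) unfolding C1_on_def by blast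
  show ?thesis
    unfolding C1_on_def
  proof (intro exI conjI ballI)
    show "((\<lambda>z. G z + J z) has_derivative blinfun_apply (G' z + J' z)) (at z)" if "z \<in> M \<inter> N" for z
      using has_derivative_add[OF G(3) J(3), of z] that by (simp add: plus_blinfun.rep_eq)
    show "continuous_on (M \<inter> N) (\<lambda>z. G' z + J' z)"
      by (intro continuous_intros continuous_on_subset[OF G(4)] continuous_on_subset[OF J(4)]) auto
  qed (use G J in auto)
qed

lemma C1_on_bilinear:
  fixes F :: "'a::euclidean_space \<Rightarrow> 'b::real_normed_vector"
  assumes "bounded_bilinear pr" "C1_on S F" "C1_on S H"
  shows "C1_on S (\<lambda>z. pr (F z) (H z))"
proof -
  interpret bounded_bilinear pr by fact
  obtain M G G' where G: "open M" "S \<subseteq> M" "\<And>z. z \<in> M \<Longrightarrow> (G has_derivative blinfun_apply (G' z)) (at z)"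
    "continuous_on M G'" "\<And>z. z \<in> S \<Longrightarrow> G z = F z"
    using assms(2) unfolding C1_on_def by blast
  obtain N J J' where J: "open N" "S \<subseteq> N" "\<And>z. z \<in> N \<Longrightarrow> (J has_derivative blinfun_apply (J' z)) (at z)"
    "continuous_on N J'" "\<And>z. z \<in> S \<Longrightarrow> J z = H z"
    using assms(3) unfolding C1_on_def by blast
  define D where "D z = Blinfun (\<lambda>v. pr (G z) (J' z v) + pr (G' z v) (J z))" for z
  have D: "blinfun_apply (D z) = (\<lambda>v. pr (G z) (J' z v) + pr (G' z v) (J z))" for z
    unfolding D_def
    by (rule bounded_linear_Blinfun_apply)
      (intro bounded_linear_add bounded_linear_compose[OF bounded_linear_right]
        bounded_linear_compose[OF bounded_linear_left] blinfun.bounded_linear_right)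
  have cont: "continuous_on (M \<inter> N) G" "continuous_on (M \<inter> N) J"
    using has_derivative_continuous[OF G(3)] has_derivative_continuous[OF J(3)]
    by (auto intro!: continuous_at_imp_continuous_on)
  show ?thesis
    unfolding C1_on_def
  proof (intro exI conjI ballI)
    show "((\<lambda>z. pr (G z) (J z)) has_derivative blinfun_apply (D z)) (at z)" if "z \<in> M \<inter> N" for z
      using FDERIV[OF G(3) J(3), of z] that by (simp add: D)
    show "continuous_on (M \<inter> N) D"
    proof (rule continuous_on_blinfun_componentwise)
      show "continuous_on (M \<inter> N) (\<lambda>z. blinfun_apply (D z) i)" for i
        unfolding D
        by (intro continuous_on_add continuous_on cont
            blinfun.continuous_on continuous_on_const
            continuous_on_subset[OF G(4)] continuous_on_subset[OF J(4)]) auto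
    qed
  qed (use G J in auto)
qed

lemma bounded_bilinear_matrix_vector_mult:
  "bounded_bilinear ((*v) :: real^'m^'n \<Rightarrow> real^'m \<Rightarrow> real^'n)"
  unfolding bilinear_conv_bounded_bilinear[symmetric] bilinear_def
  by (auto intro!: linearI simp: matrix_vector_right_distrib matrix_vector_mult_add_rdistrib
      matrix_vector_mult_scaleR scaleR_matrix_vector_assoc)

section \<open>Differentiability of flows in compact convex sets\<close>

locale invariant_flow =
  fixes X :: "'a::euclidean_space set" and F :: "'a \<Rightarrow> 'a" and \<phi> :: "'a \<Rightarrow> real \<Rightarrow> 'a" and T :: real
  assumes compact_X: "compact X" and convex_X: "convex X" and C1_F: "C1_on X F" and T_pos: "0 < T"
    and flow_0: "\<And>z. z \<in> X \<Longrightarrow> \<phi> z 0 = z"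
    and flow_in: "\<And>z s. z \<in> X \<Longrightarrow> s \<in> {0..T} \<Longrightarrow> \<phi> z s \<in> X"
    and flow_ode: "\<And>z s. z \<in> X \<Longrightarrow> s \<in> {0..T} \<Longrightarrow>
      (\<phi> z has_vector_derivative F (\<phi> z s)) (at s within {0..T})"
begin

lemma flow_continuous: "z \<in> X \<Longrightarrow> continuous_on {0..T} (\<phi> z)"
  using has_vector_derivative_continuous[OF flow_ode]
  by (simp add: continuous_on_eq_continuous_within)

lemma flow_lipschitz:
  assumes K: "0 \<le> K" "\<And>y z. y \<in> X \<Longrightarrow> z \<in> X \<Longrightarrow> norm (F y - F z) \<le> K * norm (y - z)"
    and "y \<in> X" "z \<in> X" "s \<in> {0..T}"
  shows "norm (\<phi> y s - \<phi> z s) \<le> exp ((2 * K + 1) * T) * norm (y - z)"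
proof -
  have "norm (\<phi> y s - \<phi> z s) \<le> exp ((2 * K + 1) * T) * norm (\<phi> y 0 - \<phi> z 0)"
    by (rule norm_linear_growth[where w' = "\<lambda>s. F (\<phi> y s) - F (\<phi> z s)"])
      (use assms flow_in in \<open>auto intro!: derivative_intros flow_ode\<close>)
  then show ?thesis using assms by (simp add: flow_0)
qed

text \<open>The derivative in the initial state solves the linearized equation, as does
  \<open>s \<mapsto> F (\<phi> x s)\<close>; uniqueness for that equation gives the last claim.\<close>

lemma flow_differentiable_initial:
  assumes x: "x \<in> X"
  obtains Y :: "real \<Rightarrow> 'a \<Rightarrow>\<^sub>L 'a" where
    "\<And>s. s \<in> {0..T} \<Longrightarrow> ((\<lambda>z. \<phi> z s) has_derivative blinfun_apply (Y s)) (at x within X)"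
    "\<And>s. s \<in> {0..T} \<Longrightarrow> Y s (F x) = F (\<phi> x s)"
proof -
  obtain F' where F': "\<And>z. z \<in> X \<Longrightarrow> (F has_derivative blinfun_apply (F' z)) (at z within X)"
    and cont': "continuous_on X F'"
    using C1_on_derivative[OF C1_F] by metis
  obtain K where K0: "0 \<le> K" and K': "\<And>z. z \<in> X \<Longrightarrow> norm (F' z) \<le> K"
    and K: "\<And>y z. y \<in> X \<Longrightarrow> z \<in> X \<Longrightarrow> norm (F y - F z) \<le> K * norm (y - z)"
    using continuous_derivative_imp_lipschitz[OF compact_X convex_X F' cont'] by metis
  have "continuous_on {0..T} (\<lambda>s. F' (\<phi> x s))"
    by (rule continuous_on_compose2[OF cont' flow_continuous[OF x]]) (use flow_in x in auto)
  then obtain Y where Y0: "Y 0 = id_blinfun"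
    and Y: "\<And>s. s \<in> {0..T} \<Longrightarrow> (Y has_vector_derivative F' (\<phi> x s) o\<^sub>L Y s) (at s within {0..T})"
    using linear_ode_fundamental_solution[of T "\<lambda>s. F' (\<phi> x s)"] T_pos by auto
  have Yv: "((\<lambda>s. Y s v) has_vector_derivative F' (\<phi> x s) (Y s v)) (at s within {0..T})"
    if "s \<in> {0..T}" for s v
    using bounded_linear.has_vector_derivative[OF blinfun.bounded_linear_left Y[OF that]] by simp
  have A_le: "norm (F' (\<phi> x s) v) \<le> K * norm v" if "s \<in> {0..T}" for s v
    using norm_blinfun[of "F' (\<phi> x s)" v] K'[OF flow_in[OF x that]]
    by (meson mult_right_mono norm_ge_zero order_trans)
  have Fx: "Y s (F x) = F (\<phi> x s)" if s: "s \<in> {0..T}" for s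
  proof -
    have "norm (Y s (F x) - F (\<phi> x s))
        \<le> exp ((2 * K + 1) * T) * norm (Y 0 (F x) - F (\<phi> x 0))"
    proof (rule norm_linear_growth[OF _ _ K0 s])
      fix r assume r: "r \<in> {0..T}"
      have "((\<lambda>r. F (\<phi> x r)) has_vector_derivative F' (\<phi> x r) (F (\<phi> x r))) (at r within {0..T})"
      proof -
        have "(F has_derivative blinfun_apply (F' (\<phi> x r))) (at (\<phi> x r) within \<phi> x ` {0..T})"
          using F' flow_in x r by (intro has_derivative_subset[OF F']) auto
        from has_derivative_in_compose[OF flow_ode[OF x r, unfolded has_vector_derivative_def] this]
        show ?thesis
          by (simp add: has_vector_derivative_def blinfun.scaleR_right)
      qed
      then show "((\<lambda>r. Y r (F x) - F (\<phi> x r)) has_vector_derivative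
          F' (\<phi> x r) (Y r (F x) - F (\<phi> x r))) (at r within {0..T})"
        by (auto simp: blinfun.diff_right intro!: has_vector_derivative_diff Yv r)
      show "norm (F' (\<phi> x r) (Y r (F x) - F (\<phi> x r))) \<le> K * norm (Y r (F x) - F (\<phi> x r))"
        by (rule A_le[OF r])
    qed
    then show ?thesis by (simp add: Y0 flow_0 x)
  qed
  have "((\<lambda>z. \<phi> z s) has_derivative blinfun_apply (Y s)) (at x within X)" if s: "s \<in> {0..T}" for s
    unfolding has_derivative_within_alt
  proof (intro conjI allI impI blinfun.bounded_linear_right)
    fix e :: real assume e: "0 < e"
    define M where "M = exp ((2 * K + 1) * T)"
    have M0: "0 < M" by (simp add: M_def)
    define \<epsilon> where "\<epsilon> = e / (M * (M * T + 1))"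
    have MT: "0 < M * T + 1" using M0 T_pos by (simp add: add_pos_pos)
    have "0 < \<epsilon>" using e M0 MT by (simp add: \<epsilon>_def)
    then obtain d where d: "0 < d" "\<And>y z. y \<in> X \<Longrightarrow> z \<in> X \<Longrightarrow> norm (z - y) < d \<Longrightarrow>
        norm (F z - F y - F' y (z - y)) \<le> \<epsilon> * norm (z - y)"
      using continuous_derivative_imp_uniformly_differentiable[OF compact_X convex_X F' cont'] by metis
    show "\<exists>d>0. \<forall>z\<in>X. norm (z - x) < d \<longrightarrow>
        norm (\<phi> z s - \<phi> x s - Y s (z - x)) \<le> e * norm (z - x)"
    proof (intro exI[of _ "d / M"] conjI ballI impI)
      show "0 < d / M" using d M0 by simp
      fix z assume z: "z \<in> X" and zx: "norm (z - x) < d / M"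
      define n where "n = norm (z - x)"
      define w where "w r = \<phi> z r - \<phi> x r - Y r (z - x)" for r
      have "(norm (w s))\<^sup>2 \<le> exp ((2 * K + 1) * s) * ((norm (w 0))\<^sup>2 + (\<epsilon> * (M * n))\<^sup>2 * s)"
      proof (rule norm_squared_linear_growth[OF _ _ K0 s])
        fix r assume r: "r \<in> {0..T}"
        show "(w has_vector_derivative F (\<phi> z r) - F (\<phi> x r) - F' (\<phi> x r) (Y r (z - x)))
            (at r within {0..T})"
          unfolding w_def by (intro has_vector_derivative_diff flow_ode Yv r x z)
        have le: "norm (\<phi> z r - \<phi> x r) \<le> M * n"
          unfolding M_def n_def by (rule flow_lipschitz[OF K0 K z x r])
        also have "\<dots> < d" using zx M0 by (simp add: n_def field_simps)
        finally have "norm (F (\<phi> z r) - F (\<phi> x r) - F' (\<phi> x r) (\<phi> z r - \<phi> x r))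
            \<le> \<epsilon> * norm (\<phi> z r - \<phi> x r)"
          by (intro d(2) flow_in x z r)
        also have "\<dots> \<le> \<epsilon> * (M * n)"
          using le \<open>0 < \<epsilon>\<close> by simp
        finally have 1: "norm (F (\<phi> z r) - F (\<phi> x r) - F' (\<phi> x r) (\<phi> z r - \<phi> x r)) \<le> \<epsilon> * (M * n)" .
        have "F (\<phi> z r) - F (\<phi> x r) - F' (\<phi> x r) (Y r (z - x))
            = F' (\<phi> x r) (w r) + (F (\<phi> z r) - F (\<phi> x r) - F' (\<phi> x r) (\<phi> z r - \<phi> x r))"
          by (simp add: w_def blinfun.diff_right)
        also have "norm \<dots> \<le> K * norm (w r) + \<epsilon> * (M * n)"
          by (intro norm_triangle_mono A_le r 1)
        finally show "norm (F (\<phi> z r) - F (\<phi> x r) - F' (\<phi> x r) (Y r (z - x)))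
            \<le> K * norm (w r) + \<epsilon> * (M * n)" .
      qed
      also have "w 0 = 0" by (simp add: w_def Y0 flow_0 x z)
      also have "exp ((2 * K + 1) * s) * ((norm (0::'a))\<^sup>2 + (\<epsilon> * (M * n))\<^sup>2 * s)
          \<le> M * ((\<epsilon> * (M * n))\<^sup>2 * T)"
        using s K0 unfolding M_def
        by (simp, intro mult_mono) (auto intro: mult_left_mono)
      also have "\<dots> = M * T * (e * n / (M * T + 1))\<^sup>2"
        using M0 by (simp add: \<epsilon>_def power_mult_distrib power_divide)
      also have "\<dots> \<le> (M * T + 1)\<^sup>2 * (e * n / (M * T + 1))\<^sup>2"
        using M0 T_pos
        by (intro mult_right_mono[OF _ zero_le_power2]) (auto simp: power2_eq_square algebra_simps)
      also have "\<dots> = (e * n)\<^sup>2"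
        using MT by (simp add: power_divide)
      finally have "norm (w s) \<le> e * n"
        by (rule power2_le_imp_le) (use e in \<open>auto simp: n_def\<close>)
      then show "norm (\<phi> z s - \<phi> x s - Y s (z - x)) \<le> e * norm (z - x)"
        by (simp add: w_def n_def)
    qed
  qed
  then show thesis using that[of Y] Fx by blast
qed

lemma flow_field_continuous:
  assumes x: "x \<in> X" and s: "s \<in> {0..T}"
  shows "continuous (at (x, s) within X \<times> {0..T}) (\<lambda>(z, r). F (\<phi> z r))"
proof -
  obtain F' where F': "\<And>z. z \<in> X \<Longrightarrow> (F has_derivative blinfun_apply (F' z)) (at z within X)"
    and cont': "continuous_on X F'"
    using C1_on_derivative[OF C1_F] by metis
  obtain K where K0: "0 \<le> K"
    and K: "\<And>y z. y \<in> X \<Longrightarrow> z \<in> X \<Longrightarrow> norm (F y - F z) \<le> K * norm (y - z)"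
    using continuous_derivative_imp_lipschitz[OF compact_X convex_X F' cont'] by metis
  define M where "M = exp ((2 * K + 1) * T)"
  have le: "norm (F (\<phi> z r) - F (\<phi> x s)) \<le> K * (M * norm (z - x) + norm (\<phi> x r - \<phi> x s))"
    if "z \<in> X" "r \<in> {0..T}" for z r
  proof -
    have "norm (F (\<phi> z r) - F (\<phi> x s)) \<le> K * norm (\<phi> z r - \<phi> x s)"
      by (intro K flow_in x s that)
    also have "\<phi> z r - \<phi> x s = (\<phi> z r - \<phi> x r) + (\<phi> x r - \<phi> x s)" by simp
    also have "K * norm \<dots> \<le> K * (M * norm (z - x) + norm (\<phi> x r - \<phi> x s))"
      unfolding M_def
      by (intro mult_left_mono K0 norm_triangle_mono flow_lipschitz K x that order_refl)
    finally show ?thesis .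
  qed
  have "continuous (at (x, s) within X \<times> {0..T}) (\<lambda>p. \<phi> x (snd p))"
    using continuous_on_compose2[OF flow_continuous[OF x] continuous_on_snd[OF continuous_on_id], of "X \<times> {0..T}"]
      x s by (auto simp: continuous_on_eq_continuous_within)
  then have "((\<lambda>p. K * (M * norm (fst p - x) + norm (\<phi> x (snd p) - \<phi> x s))) \<longlongrightarrow>
      K * (M * norm (fst (x, s) - x) + norm (\<phi> x (snd (x, s)) - \<phi> x s))) (at (x, s) within X \<times> {0..T})"
    unfolding continuous_within by (intro tendsto_intros) auto
  then have lim: "((\<lambda>p. K * (M * norm (fst p - x) + norm (\<phi> x (snd p) - \<phi> x s))) \<longlongrightarrow> 0)
      (at (x, s) within X \<times> {0..T})"
    by simp
  have "((\<lambda>p. (case p of (z, r) \<Rightarrow> F (\<phi> z r)) - F (\<phi> x s)) \<longlongrightarrow> 0) (at (x, s) within X \<times> {0..T})"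
    by (rule Lim_null_comparison[OF _ lim])
      (auto simp: eventually_at_filter intro!: always_eventually le)
  then show ?thesis
    unfolding continuous_within by (subst Lim_null) simp
qed

lemma flow_differentiable:
  assumes x: "x \<in> X"
  obtains Y :: "real \<Rightarrow> 'a \<Rightarrow>\<^sub>L 'a" where
    "\<And>s. s \<in> {0..T} \<Longrightarrow> ((\<lambda>z. \<phi> z s) has_derivative blinfun_apply (Y s)) (at x within X)"
    "\<And>s. s \<in> {0..T} \<Longrightarrow> ((\<lambda>(z, r). \<phi> z r) has_derivative (\<lambda>(v, h). Y s v + h *\<^sub>R F (\<phi> x s)))
      (at (x, s) within X \<times> {0..T})"
    "\<And>s. s \<in> {0..T} \<Longrightarrow> Y s (F x) = F (\<phi> x s)"
proof -
  obtain Y :: "real \<Rightarrow> 'a \<Rightarrow>\<^sub>L 'a" where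
    Y: "\<And>s. s \<in> {0..T} \<Longrightarrow> ((\<lambda>z. \<phi> z s) has_derivative blinfun_apply (Y s)) (at x within X)"
    "\<And>s. s \<in> {0..T} \<Longrightarrow> Y s (F x) = F (\<phi> x s)"
    using flow_differentiable_initial[OF x] by metis
  have "((\<lambda>(z, r). \<phi> z r) has_derivative (\<lambda>(v, h). Y s v + h *\<^sub>R F (\<phi> x s)))
      (at (x, s) within X \<times> {0..T})" if s: "s \<in> {0..T}" for s
  proof -
    have "((\<lambda>(z, r). \<phi> z r) has_derivative
        (\<lambda>(v, h). Y s v + blinfun_scaleR_left (F (\<phi> x s)) h)) (at (x, s) within X \<times> {0..T})"
    proof (rule has_derivative_partialsI[where fy = "\<lambda>z r. blinfun_scaleR_left (F (\<phi> z r))"])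
      show "((\<lambda>r. \<phi> z r) has_derivative blinfun_apply (blinfun_scaleR_left (F (\<phi> z r))))
          (at r within {0..T})" if "z \<in> X" "r \<in> {0..T}" for z r
        using flow_ode[OF that] by (simp add: has_vector_derivative_def)
      show "continuous (at (x, s) within X \<times> {0..T}) (\<lambda>(z, r). blinfun_scaleR_left (F (\<phi> z r)))"
        using bounded_linear.continuous[OF bounded_linear_blinfun_scaleR_left flow_field_continuous[OF x s]]
        by (simp add: case_prod_unfold)
    qed (use Y s in auto)
    then show ?thesis by simp
  qed
  then show thesis using that[of Y] Y by blast
qed

lemma flow_jointly_continuous: "continuous_on (X \<times> {0..T}) (\<lambda>(z, r). \<phi> z r)"
  unfolding continuous_on_eq_continuous_within
proof (intro ballI)
  fix p assume "p \<in> X \<times> {0..T}"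
  then obtain x s where p: "p = (x, s)" "x \<in> X" "s \<in> {0..T}" by blast
  obtain Y :: "real \<Rightarrow> 'a \<Rightarrow>\<^sub>L 'a" where
    "\<And>s. s \<in> {0..T} \<Longrightarrow> ((\<lambda>(z, r). \<phi> z r) has_derivative (\<lambda>(v, h). Y s v + h *\<^sub>R F (\<phi> x s)))
      (at (x, s) within X \<times> {0..T})"
    using flow_differentiable[OF p(2)] by metis
  then show "continuous (at p within X \<times> {0..T}) (\<lambda>(z, r). \<phi> z r)"
    using p has_derivative_continuous by blast
qed

end

section \<open>Velocities of curves in a set\<close>

text \<open>A derivative within \<open>X\<close> is not unique if \<open>X\<close> is lower-dimensional, but all derivatives
  agree on these vectors.\<close>

definition velocity_in :: "'a::real_normed_vector set \<Rightarrow> 'a \<Rightarrow> 'a \<Rightarrow> bool" where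
  "velocity_in X y w \<longleftrightarrow> (\<exists>\<gamma> t I. at t within I \<noteq> bot \<and> t \<in> I \<and> \<gamma> ` I \<subseteq> X \<and> \<gamma> t = y \<and>
     (\<gamma> has_vector_derivative w) (at t within I))"

lemma has_vector_derivative_compose_within:
  assumes "(\<gamma> has_vector_derivative w) (at t within I)" "(F has_derivative L) (at (\<gamma> t) within X)"
    "\<gamma> ` I \<subseteq> X"
  shows "((\<lambda>r. F (\<gamma> r)) has_vector_derivative L w) (at t within I)"
proof -
  interpret L: bounded_linear L using assms(2) by (rule has_derivative_bounded_linear)
  show ?thesis
    using has_derivative_in_compose[OF assms(1)[unfolded has_vector_derivative_def]
        has_derivative_subset[OF assms(2,3)]]
    by (simp add: has_vector_derivative_def L.scaleR)
qed

lemma velocity_in_image: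
  assumes "velocity_in X y w" "(F has_derivative L) (at y within X)" "F ` X \<subseteq> Z"
  shows "velocity_in Z (F y) (L w)"
proof -
  obtain \<gamma> t I where "at t within I \<noteq> bot" "t \<in> I" "\<gamma> ` I \<subseteq> X" "\<gamma> t = y"
    "(\<gamma> has_vector_derivative w) (at t within I)"
    using assms(1) unfolding velocity_in_def by blast
  then show ?thesis
    using has_vector_derivative_compose_within[of \<gamma> w t I F L X] assms(2,3)
    unfolding velocity_in_def by (intro exI[of _ "\<lambda>r. F (\<gamma> r)"] exI[of _ t] exI[of _ I]) auto
qed

lemma has_derivative_unique_velocity:
  assumes "velocity_in X y w" "(F has_derivative L) (at y within X)" "(F has_derivative L') (at y within X)"
  shows "L w = L' w"
proof -
  obtain \<gamma> t I where "at t within I \<noteq> bot" "\<gamma> ` I \<subseteq> X" "\<gamma> t = y"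
    "(\<gamma> has_vector_derivative w) (at t within I)"
    using assms(1) unfolding velocity_in_def by blast
  then show ?thesis
    using has_vector_derivative_compose_within[of \<gamma> w t I F _ X] assms(2,3)
      vector_derivative_unique_within by metis
qed

lemma grad_within_inner_velocity:
  assumes "velocity_in S y w" "(F has_derivative L) (at y within S)"
  shows "grad_within S F y \<bullet> w = L w"
proof -
  define D where "D = frechet_derivative F (at y within S)"
  have D: "(F has_derivative D) (at y within S)"
    unfolding D_def using assms(2) frechet_derivative_works differentiableI by blast
  then interpret D: bounded_linear D by (rule has_derivative_bounded_linear)
  have "grad_within S F y \<bullet> w = (\<Sum>i\<in>UNIV. D (w $ i *s axis i 1))"
    by (simp add: grad_within_def D_def[symmetric] inner_vec_def scalar_mult_eq_scaleR D.scaleR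
        mult.commute)
  also have "\<dots> = D w"
    by (simp add: D.sum[symmetric] basis_expansion)
  also have "\<dots> = L w"
    by (rule has_derivative_unique_velocity[OF assms(1) D assms(2)])
  finally show ?thesis .
qed

lemma jacobian_mult_velocity:
  fixes F :: "real^'n \<Rightarrow> real^'m"
  assumes "velocity_in S y w" "(F has_derivative L) (at y within S)"
  shows "jacobian F (at y within S) *v w = L w"
proof -
  have "(F has_derivative (*v) (jacobian F (at y within S))) (at y within S)"
    using assms(2) differentiableI jacobian_works by blast
  then show ?thesis
    by (rule has_derivative_unique_velocity[OF assms(1) _ assms(2)])
qed

section \<open>The comparison argument\<close>

text \<open>While \<open>v\<close> is negative, the bound makes it nondecreasing, so it cannot have left
  the nonnegative reals.\<close>

lemma barrier_nonneg:
  fixes v :: "real \<Rightarrow> real"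
  assumes D: "finite D" and ab: "a \<le> b" and cont: "continuous_on {a..b} v" and init: "0 \<le> v a"
    and deriv: "\<And>t. t \<in> {a<..<b} - D \<Longrightarrow> (v has_real_derivative v' t) (at t)"
    and bound: "\<And>t. t \<in> {a<..<b} - D \<Longrightarrow> - \<alpha> (v t) \<le> v' t"
    and \<alpha>: "\<And>r. r < 0 \<Longrightarrow> \<alpha> r \<le> 0"
  shows "0 \<le> v b"
proof (rule ccontr)
  assume "\<not> 0 \<le> v b"
  define Z where "Z = {a..b} \<inter> v -` {0..}"
  have Z: "closed Z" "Z \<noteq> {}" "bdd_above Z"
    using continuous_closed_preimage[OF cont, of "{0..}"] init ab
    by (auto simp: Z_def intro: bdd_above_Int1)
  define c where "c = Sup Z"
  have "c \<in> Z"
    unfolding c_def by (rule closed_contains_Sup[OF Z(2,3,1)])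
  then have c: "a \<le> c" "c \<le> b" "0 \<le> v c" by (auto simp: Z_def)
  have neg: "v t < 0" if "c < t" "t \<le> b" for t
  proof (rule ccontr)
    assume "\<not> v t < 0"
    then have "t \<in> Z" using that c by (simp add: Z_def)
    then have "t \<le> c" unfolding c_def by (rule cSup_upper[OF _ Z(3)])
    then show False using that by simp
  qed
  define v0 where "v0 t = (if t \<in> D \<union> {c, b} then 0 else v' t)" for t
  have "(v0 has_integral v b - v c) {c..b}"
  proof (rule fundamental_theorem_of_calculus_interior_strong[OF D c(2)])
    show "continuous_on {c..b} v"
      using cont by (rule continuous_on_subset) (use c in auto)
    show "(v has_vector_derivative v0 t) (at t)" if "t \<in> {c<..<b} - D" for t
      using deriv[of t] that c
      by (simp add: v0_def has_real_derivative_iff_has_vector_derivative)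
  qed
  moreover have "0 \<le> v0 t" if "t \<in> {c..b}" for t
    using that c bound[of t] neg[of t] \<alpha>[of "v t"] by (auto simp: v0_def)
  ultimately have "0 \<le> v b - v c"
    by (rule has_integral_nonneg)
  then show False using c \<open>\<not> 0 \<le> v b\<close> by simp
qed

section \<open>The constraints as derivatives of the barriers\<close>

lemma has_derivative_slices3:
  assumes L: "((\<lambda>(y, t, s). h y t s) has_derivative L) (at (y, t, s) within X \<times> I \<times> J)"
    and "y \<in> X" "t \<in> I" "s \<in> J"
  shows "((\<lambda>z. h z t s) has_derivative (\<lambda>v. L (v, 0, 0))) (at y within X)"
    and "((\<lambda>r. h y r s) has_vector_derivative L (0, 1, 0)) (at t within I)"
    and "((\<lambda>r. h y t r) has_vector_derivative L (0, 0, 1)) (at s within J)"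
proof -
  have 1: "((\<lambda>z. (z, t, s)) has_derivative (\<lambda>v. (v, 0, 0))) (at y within X)"
    by (auto intro!: derivative_eq_intros simp: zero_prod_def)
  show "((\<lambda>z. h z t s) has_derivative (\<lambda>v. L (v, 0, 0))) (at y within X)"
    using has_derivative_in_compose[OF 1 has_derivative_subset[OF L]] assms by auto
  have 2: "((\<lambda>r. (y, r, s)) has_vector_derivative (0, 1, 0)) (at t within I)"
    unfolding has_vector_derivative_def by (auto intro!: derivative_eq_intros)
  show "((\<lambda>r. h y r s) has_vector_derivative L (0, 1, 0)) (at t within I)"
    using has_vector_derivative_compose_within[OF 2 L] assms by auto
  have 3: "((\<lambda>r. (y, t, r)) has_vector_derivative (0, 0, 1)) (at s within J)"
    unfolding has_vector_derivative_def by (auto intro!: derivative_eq_intros)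
  show "((\<lambda>r. h y t r) has_vector_derivative L (0, 0, 1)) (at s within J)"
    using has_vector_derivative_compose_within[OF 3 L] assms by auto
qed

lemma has_derivative_slices2:
  assumes L: "((\<lambda>(y, q). h y q) has_derivative L) (at (y, q) within X \<times> I)"
    and "y \<in> X" "q \<in> I"
  shows "((\<lambda>z. h z q) has_derivative (\<lambda>v. L (v, 0))) (at y within X)"
    and "((\<lambda>r. h y r) has_vector_derivative L (0, 1)) (at q within I)"
proof -
  have 1: "((\<lambda>z. (z, q)) has_derivative (\<lambda>v. (v, 0))) (at y within X)"
    by (auto intro!: derivative_eq_intros)
  show "((\<lambda>z. h z q) has_derivative (\<lambda>v. L (v, 0))) (at y within X)"
    using has_derivative_in_compose[OF 1 has_derivative_subset[OF L]] assms by auto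
  have 2: "((\<lambda>r. (y, r)) has_vector_derivative (0, 1)) (at q within I)"
    unfolding has_vector_derivative_def by (auto intro!: derivative_eq_intros)
  show "((\<lambda>r. h y r) has_vector_derivative L (0, 1)) (at q within I)"
    using has_vector_derivative_compose_within[OF 2 L] assms by auto
qed

lemma at_within_halfopen_neq_bot:
  fixes t :: real
  assumes "t \<in> {a..<b}"
  shows "at t within {a..<b} \<noteq> bot"
  using assms by (auto simp: trivial_limit_within)

locale ocbf_model =
  fixes R :: "('n::finite, 'm::finite, 'd::finite) ocbf"
  assumes setting: "ocbf_setting R"
    and backup_C1: "\<And>k. C1_on (state_set R) (backup R k)"
    and hC_C1: "\<And>k j. j \<in> {1..num_occ R k} \<Longrightarrow>
      C1_on (state_set R \<times> upd_interval R k \<times> {0..horizon R}) (\<lambda>(y, t, s). hC R j y t s)"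
    and hS_C1: "\<And>k j. j \<in> {1..num_occ R k} \<Longrightarrow>
      C1_on (state_set R \<times> term_interval R k) (\<lambda>(y, q). hS R j y q)"
    and flow: "\<And>k. is_backup_flow R k"
begin

abbreviation "X \<equiv> state_set R"
abbreviation "T \<equiv> horizon R"

lemma horizon_pos: "0 < T"
  using setting by (simp add: ocbf_setting_def)

sublocale invariant_flow X "f_b R k" "backup_flow R k" T for k
proof
  show "C1_on X (f_b R k)"
    unfolding f_b_def[abs_def]
    by (intro C1_on_add C1_on_bilinear[OF bounded_bilinear_matrix_vector_mult] backup_C1)
      (use setting in \<open>auto simp: ocbf_setting_def\<close>)
qed (use setting flow[of k] in \<open>auto simp: ocbf_setting_def is_backup_flow_def\<close>)

lemma upd_index_eq:
  assumes "t \<in> upd_interval R k"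
  shows "upd_index R t = k"
  unfolding upd_index_def
proof (rule the_equality, rule assms)
  fix l assume l: "t \<in> upd_interval R l"
  have mono: "strict_mono (upd_time R)"
    using setting by (simp add: ocbf_setting_def)
  have "upd_time R k < upd_time R (Suc l)" "upd_time R l < upd_time R (Suc k)"
    using assms l by (auto simp: upd_interval_def)
  then have "k < Suc l" "l < Suc k"
    using strict_mono_less[OF mono] by blast+
  then show "l = k" by simp
qed

lemma upd_interval_cover:
  assumes "t_init R \<le> t"
  obtains k where "t \<in> upd_interval R k"
proof -
  have "(\<Union>k. upd_interval R k) = {t_init R..}"
    using setting by (simp add: ocbf_setting_def)
  then show thesis using assms that by blast
qed

lemma upd_interval_ge:
  assumes "t \<in> upd_interval R k"
  shows "t_init R \<le> t"
proof -
  have "(\<Union>k. upd_interval R k) = {t_init R..}"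
    using setting by (simp add: ocbf_setting_def)
  then show ?thesis using assms by blast
qed

lemma at_within_upd_interval_neq_bot: "t \<in> upd_interval R k \<Longrightarrow> at t within upd_interval R k \<noteq> bot"
  unfolding upd_interval_def by (rule at_within_halfopen_neq_bot)

lemma term_interval_eq: "term_interval R k = {upd_time R k + T ..< upd_time R (Suc k) + T}"
  by (auto simp: term_interval_def upd_interval_def)

lemma at_within_horizon_neq_bot: "s \<in> {0..T} \<Longrightarrow> at s within {0..T} \<noteq> bot"
  using horizon_pos by (auto simp: trivial_limit_within islimpt_Icc)

lemma velocity_in_backup: "y \<in> X \<Longrightarrow> velocity_in X y (f_b R k y)"
  unfolding velocity_in_def
  using flow_0[of y k] flow_in[of y _ k] flow_ode[of y 0 k] horizon_pos at_within_horizon_neq_bot[of 0]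
  by (intro exI[of _ "backup_flow R k y"] exI[of _ 0] exI[of _ "{0..T}"]) auto

lemma Phi_b_velocity:
  assumes "t \<in> upd_interval R k" "velocity_in X x w"
    and "((\<lambda>z. backup_flow R k z s) has_derivative Y) (at x within X)"
  shows "Phi_b R t x s *v w = Y w"
  using jacobian_mult_velocity[OF assms(2,3)] by (simp add: Phi_b_def phi_b_def upd_index_eq[OF assms(1)])

lemma c_C_A_C_eq:
  assumes t: "t \<in> upd_interval R k"
    and Y: "((\<lambda>z. backup_flow R k z (\<tau> - t)) has_derivative Y) (at x within X)"
    and w: "w = drift R x + actuation R x *v u" "velocity_in X x w"
    and y: "y = backup_flow R k x (\<tau> - t)"
  shows "c_C R j x t \<tau> + A_C R j x t \<tau> \<bullet> u
    = grad_hC R j y t (\<tau> - t) \<bullet> (Y w - f_b R k y) + dt_hC R j y t (\<tau> - t) - ds_hC R j y t (\<tau> - t)"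
proof -
  have "c_C R j x t \<tau> + A_C R j x t \<tau> \<bullet> u
    = grad_hC R j y t (\<tau> - t) \<bullet> (Phi_b R t x (\<tau> - t) *v w - f_b R k y)
      + dt_hC R j y t (\<tau> - t) - ds_hC R j y t (\<tau> - t)"
    by (simp add: c_C_def A_C_def Let_def phi_b_def upd_index_eq[OF t] y w(1) dot_lmul_matrix
        matrix_vector_mul_assoc[symmetric] matrix_vector_right_distrib inner_diff_right inner_add_right)
  then show ?thesis
    by (simp add: Phi_b_velocity[OF t w(2) Y])
qed

lemma c_S_A_S_eq:
  assumes t: "t \<in> upd_interval R k"
    and Y: "((\<lambda>z. backup_flow R k z T) has_derivative Y) (at x within X)"
    and w: "w = drift R x + actuation R x *v u" "velocity_in X x w"
    and y: "y = backup_flow R k x T"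
  shows "c_S R j x t + A_S R j x t \<bullet> u = grad_hS R j y (t + T) \<bullet> Y w + dq_hS R j y (t + T)"
proof -
  have "c_S R j x t + A_S R j x t \<bullet> u
    = grad_hS R j y (t + T) \<bullet> (Phi_b R t x T *v w) + dq_hS R j y (t + T)"
    by (simp add: c_S_def A_S_def Let_def phi_b_def upd_index_eq[OF t] y w(1) dot_lmul_matrix
        matrix_vector_mul_assoc[symmetric] matrix_vector_right_distrib inner_add_right)
  then show ?thesis
    by (simp add: Phi_b_velocity[OF t w(2) Y])
qed

lemma hC_derivative_eq:
  assumes L: "((\<lambda>(y, t, s). hC R j y t s) has_derivative L)
      (at (y, t, s) within X \<times> upd_interval R k \<times> {0..T})"
    and y: "y \<in> X" and t: "t \<in> upd_interval R k" and s: "s \<in> {0..T}" and v: "velocity_in X y v"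
  shows "L (v - f_b R k y, 1, - 1)
    = grad_hC R j y t s \<bullet> (v - f_b R k y) + dt_hC R j y t s - ds_hC R j y t s"
proof -
  interpret L: bounded_linear L using L by (rule has_derivative_bounded_linear)
  note L' = has_derivative_slices3[OF L y t s]
  have dt: "dt_hC R j y t s = L (0, 1, 0)"
    unfolding dt_hC_def upd_index_eq[OF t]
    by (rule vector_derivative_within[OF at_within_upd_interval_neq_bot[OF t] L'(2)])
  have ds: "ds_hC R j y t s = L (0, 0, 1)"
    unfolding ds_hC_def by (rule vector_derivative_within[OF at_within_horizon_neq_bot[OF s] L'(3)])
  have g: "grad_hC R j y t s \<bullet> z = L (z, 0, 0)" if "velocity_in X y z" for z
    unfolding grad_hC_def by (rule grad_within_inner_velocity[OF that L'(1)])
  have "L (v - f_b R k y, 1, - 1) = L ((v, 0, 0) - (f_b R k y, 0, 0) + (0, 1, 0) - (0, 0, 1))"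
    by simp
  also have "\<dots> = L (v, 0, 0) - L (f_b R k y, 0, 0) + L (0, 1, 0) - L (0, 0, 1)"
    by (simp only: L.add L.diff)
  finally show ?thesis
    using g[OF v] g[OF velocity_in_backup[OF y]] by (simp add: dt ds inner_diff_right)
qed

lemma hS_derivative_eq:
  assumes L: "((\<lambda>(y, q). hS R j y q) has_derivative L) (at (y, q) within X \<times> term_interval R k)"
    and y: "y \<in> X" and q: "q \<in> term_interval R k" and v: "velocity_in X y v"
  shows "L (v, 1) = grad_hS R j y q \<bullet> v + dq_hS R j y q"
proof -
  interpret L: bounded_linear L using L by (rule has_derivative_bounded_linear)
  note L' = has_derivative_slices2[OF L y q]
  have k: "upd_index R (q - T) = k"
    using q by (intro upd_index_eq) (simp add: term_interval_def)
  have "at q within term_interval R k \<noteq> bot"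
    using q unfolding term_interval_eq by (rule at_within_halfopen_neq_bot)
  then have dq: "dq_hS R j y q = L (0, 1)"
    unfolding dq_hS_def k using L'(2) by (rule vector_derivative_within)
  have "grad_hS R j y q \<bullet> v = L (v, 0)"
    unfolding grad_hS_def by (rule grad_within_inner_velocity[OF v L'(1)])
  then show ?thesis
    using L.add[of "(v, 0)" "(0, 1)"] by (simp add: dq)
qed

lemma xi_C_has_derivative:
  assumes ab: "{a<..<b} \<subseteq> upd_interval R k" "\<And>r. r \<in> {a<..<b} \<Longrightarrow> \<tau> - r \<in> {0..T}"
    and j: "j \<in> {1..num_occ R k}"
    and t: "t \<in> {a<..<b}" and x: "\<And>r. r \<in> {a<..<b} \<Longrightarrow> x r \<in> X"
    and w: "w = drift R (x t) + actuation R (x t) *v u" "velocity_in X (x t) w"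
    and x': "(x has_vector_derivative w) (at t)"
  shows "((\<lambda>r. hC R j (backup_flow R k (x r) (\<tau> - r)) r (\<tau> - r)) has_real_derivative
    c_C R j (x t) t \<tau> + A_C R j (x t) t \<tau> \<bullet> u) (at t)"
proof -
  have tk: "t \<in> upd_interval R k" and s: "\<tau> - t \<in> {0..T}" using ab t by auto
  define y where "y = backup_flow R k (x t) (\<tau> - t)"
  have yX: "y \<in> X" unfolding y_def by (rule flow_in[OF x[OF t] s])
  obtain Y :: "real \<Rightarrow> (real, 'n) vec \<Rightarrow>\<^sub>L (real, 'n) vec" where
    Y: "\<And>s. s \<in> {0..T} \<Longrightarrow> ((\<lambda>z. backup_flow R k z s) has_derivative blinfun_apply (Y s)) (at (x t) within X)"
    "\<And>s. s \<in> {0..T} \<Longrightarrow> ((\<lambda>(z, r). backup_flow R k z r) has_derivative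
      (\<lambda>(v, h). Y s v + h *\<^sub>R f_b R k (backup_flow R k (x t) s))) (at (x t, s) within X \<times> {0..T})"
    using flow_differentiable[OF x[OF t], of k] by metis
  obtain L where L: "((\<lambda>(y, t, s). hC R j y t s) has_derivative blinfun_apply L)
      (at (y, t, \<tau> - t) within X \<times> upd_interval R k \<times> {0..T})"
    using C1_on_derivative[OF hC_C1[OF j]] yX tk s by (metis SigmaI)
  have vel: "velocity_in X y (Y (\<tau> - t) w)"
    unfolding y_def by (rule velocity_in_image[OF w(2) Y(1)[OF s]]) (use flow_in s in auto)
  have x'': "(x has_vector_derivative w) (at t within {a<..<b})"
    using x' by (rule has_vector_derivative_at_within)
  have "((\<lambda>r. (x r, \<tau> - r)) has_vector_derivative (w, - 1)) (at t within {a<..<b})"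
    using x'' unfolding has_vector_derivative_def by (auto intro!: derivative_eq_intros)
  from has_vector_derivative_compose_within[OF this Y(2)[OF s]]
  have \<phi>: "((\<lambda>r. backup_flow R k (x r) (\<tau> - r)) has_vector_derivative Y (\<tau> - t) w - f_b R k y)
      (at t within {a<..<b})"
    using x ab by (simp add: y_def image_subset_iff)
  have "((\<lambda>r. (backup_flow R k (x r) (\<tau> - r), r, \<tau> - r)) has_vector_derivative
      (Y (\<tau> - t) w - f_b R k y, 1, - 1)) (at t within {a<..<b})"
    using \<phi> unfolding has_vector_derivative_def by (auto intro!: derivative_eq_intros)
  from has_vector_derivative_compose_within[OF this L[unfolded y_def]]
  have "((\<lambda>r. hC R j (backup_flow R k (x r) (\<tau> - r)) r (\<tau> - r)) has_vector_derivative
      L (Y (\<tau> - t) w - f_b R k y, 1, - 1)) (at t within {a<..<b})"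
    using ab x flow_in by (auto simp: image_subset_iff)
  then show ?thesis
    unfolding c_C_A_C_eq[OF tk Y(1)[OF s] w y_def] hC_derivative_eq[OF L yX tk s vel]
    using t by (simp add: has_real_derivative_iff_has_vector_derivative at_within_open[OF t])
qed

lemma eta_has_derivative:
  assumes ab: "{a<..<b} \<subseteq> upd_interval R k" and j: "j \<in> {1..num_occ R k}"
    and t: "t \<in> {a<..<b}" and x: "\<And>r. r \<in> {a<..<b} \<Longrightarrow> x r \<in> X"
    and w: "w = drift R (x t) + actuation R (x t) *v u" "velocity_in X (x t) w"
    and x': "(x has_vector_derivative w) (at t)"
  shows "((\<lambda>r. hS R j (backup_flow R k (x r) T) (r + T)) has_real_derivative
    c_S R j (x t) t + A_S R j (x t) t \<bullet> u) (at t)"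
proof -
  have tk: "t \<in> upd_interval R k" and s: "T \<in> {0..T}" using ab t horizon_pos by auto
  have q: "r + T \<in> term_interval R k" if "r \<in> {a<..<b}" for r
    using ab that by (auto simp: term_interval_def)
  define y where "y = backup_flow R k (x t) T"
  have yX: "y \<in> X" unfolding y_def by (rule flow_in[OF x[OF t] s])
  obtain Y :: "real \<Rightarrow> (real, 'n) vec \<Rightarrow>\<^sub>L (real, 'n) vec" where
    Y: "\<And>s. s \<in> {0..T} \<Longrightarrow> ((\<lambda>z. backup_flow R k z s) has_derivative blinfun_apply (Y s)) (at (x t) within X)"
    using flow_differentiable[OF x[OF t], of k] by metis
  obtain L where L: "((\<lambda>(y, q). hS R j y q) has_derivative blinfun_apply L)
      (at (y, t + T) within X \<times> term_interval R k)"
    using C1_on_derivative[OF hS_C1[OF j]] yX q[OF t] by (metis SigmaI)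
  have vel: "velocity_in X y (Y T w)"
    unfolding y_def by (rule velocity_in_image[OF w(2) Y[OF s]]) (use flow_in s in auto)
  have x'': "(x has_vector_derivative w) (at t within {a<..<b})"
    using x' by (rule has_vector_derivative_at_within)
  from has_vector_derivative_compose_within[OF this Y[OF s]]
  have "((\<lambda>r. backup_flow R k (x r) T) has_vector_derivative Y T w) (at t within {a<..<b})"
    using x by (simp add: image_subset_iff)
  then have "((\<lambda>r. (backup_flow R k (x r) T, r + T)) has_vector_derivative (Y T w, 1))
      (at t within {a<..<b})"
    unfolding has_vector_derivative_def by (auto intro!: derivative_eq_intros)
  from has_vector_derivative_compose_within[OF this L[unfolded y_def]]
  have "((\<lambda>r. hS R j (backup_flow R k (x r) T) (r + T)) has_vector_derivative L (Y T w, 1))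
      (at t within {a<..<b})"
    using q x flow_in s by (auto simp: image_subset_iff)
  then show ?thesis
    unfolding c_S_A_S_eq[OF tk Y[OF s] w y_def] hS_derivative_eq[OF L yX q[OF t] vel]
    using t by (simp add: has_real_derivative_iff_has_vector_derivative at_within_open[OF t])
qed

section \<open>Invariance and recursive feasibility\<close>

lemma hC_along_trajectory_continuous:
  assumes "continuous_on I x" "x ` I \<subseteq> X" "I \<subseteq> upd_interval R k" "\<And>r. r \<in> I \<Longrightarrow> \<tau> - r \<in> {0..T}"
    and j: "j \<in> {1..num_occ R k}"
  shows "continuous_on I (\<lambda>r. hC R j (backup_flow R k (x r) (\<tau> - r)) r (\<tau> - r))"
proof -
  have "continuous_on I (\<lambda>r. case (x r, \<tau> - r) of (z, r) \<Rightarrow> backup_flow R k z r)"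
    by (rule continuous_on_compose2[OF flow_jointly_continuous])
      (use assms in \<open>auto intro!: continuous_intros\<close>)
  then have "continuous_on I (\<lambda>r. backup_flow R k (x r) (\<tau> - r))"
    by simp
  then have "continuous_on I (\<lambda>r. case (backup_flow R k (x r) (\<tau> - r), r, \<tau> - r) of
      (y, t, s) \<Rightarrow> hC R j y t s)"
    by (intro continuous_on_compose2[OF C1_on_imp_continuous_on[OF hC_C1[OF j]]] continuous_intros)
      (use assms flow_in in \<open>auto simp: image_subset_iff\<close>)
  then show ?thesis by simp
qed

lemma hS_along_trajectory_continuous:
  assumes "continuous_on I x" "x ` I \<subseteq> X" "I \<subseteq> upd_interval R k" and j: "j \<in> {1..num_occ R k}"
  shows "continuous_on I (\<lambda>r. hS R j (backup_flow R k (x r) T) (r + T))"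
proof -
  have "continuous_on I (\<lambda>r. case (x r, T) of (z, r) \<Rightarrow> backup_flow R k z r)"
    by (rule continuous_on_compose2[OF flow_jointly_continuous])
      (use assms horizon_pos in \<open>auto intro!: continuous_intros\<close>)
  then have "continuous_on I (\<lambda>r. backup_flow R k (x r) T)"
    by simp
  then have "continuous_on I (\<lambda>r. case (backup_flow R k (x r) T, r + T) of (y, q) \<Rightarrow> hS R j y q)"
    by (intro continuous_on_compose2[OF C1_on_imp_continuous_on[OF hS_C1[OF j]]] continuous_intros)
      (use assms flow_in horizon_pos in \<open>auto simp: image_subset_iff term_interval_def\<close>)
  then show ?thesis by simp
qed

lemma trajectory_velocity:
  assumes traj: "robot_trajectory R D u x" and t: "t \<in> {t_init R..} - D"
  shows "velocity_in X (x t) (drift R (x t) + actuation R (x t) *v u (x t) t)"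
  unfolding velocity_in_def
proof (intro exI conjI)
  show "at t within {t..<t + 1} \<noteq> bot"
    by (rule at_within_halfopen_neq_bot) simp
  show "(x has_vector_derivative drift R (x t) + actuation R (x t) *v u (x t) t) (at t within {t..<t + 1})"
    by (rule has_vector_derivative_within_subset[where S = "{t_init R..}"])
      (use traj t in \<open>auto simp: robot_trajectory_def\<close>)
  show "x ` {t..<t + 1} \<subseteq> X"
    using traj t by (auto simp: robot_trajectory_def)
qed auto

lemma trajectory_derivative:
  assumes traj: "robot_trajectory R D u x" and t: "t_init R < t" "t \<notin> D"
  shows "(x has_vector_derivative drift R (x t) + actuation R (x t) *v u (x t) t) (at t)"
proof -
  have "at t within {t_init R..} = at t"
    using t by (intro at_within_interior) simp
  moreover have "(x has_vector_derivative drift R (x t) + actuation R (x t) *v u (x t) t)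
      (at t within {t_init R..})"
    using traj t by (simp add: robot_trajectory_def)
  ultimately show ?thesis by simp
qed

lemma recoverable_iff:
  assumes "t \<in> upd_interval R k"
  shows "x \<in> recoverable R t \<longleftrightarrow> x \<in> X \<and>
    (\<forall>s\<in>{0..T}. \<forall>j\<in>{1..num_occ R k}. 0 \<le> hC R j (backup_flow R k x s) t s) \<and>
    (\<forall>j\<in>{1..num_occ R k}. 0 \<le> hS R j (backup_flow R k x T) (t + T))"
  by (simp add: recoverable_def occ_indices_def eta_def phi_b_def upd_index_eq[OF assms])

lemma terminal_margin_nonneg:
  assumes t: "t \<in> upd_interval R k" and "j \<in> {1..num_occ R k}" "y \<in> X" "0 \<le> hS R j y (t + T)"
  shows "0 \<le> hC R j y t T"
proof -
  have "\<forall>q\<ge>t_init R + T. \<forall>j\<in>occ_indices R (q - T). \<forall>y\<in>X.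
      hS R j y q \<ge> 0 \<longrightarrow> hC R j y (q - T) T \<ge> term_clearance R"
    and "0 \<le> term_clearance R"
    using setting by (auto simp: ocbf_setting_def)
  then show ?thesis
    using assms upd_interval_ge[OF t] upd_index_eq[OF t]
    by (force simp: occ_indices_def dest: spec[of _ "t + T"])
qed

text \<open>For fixed \<open>\<tau>\<close> the constraints make \<open>r \<mapsto> h\<^sub>C(\<phi>(x r, \<tau> - r), r, \<tau> - r)\<close> a barrier. It starts either
  at the update time or at \<open>\<tau> - T\<close>, where the terminal barrier provides its sign.\<close>

lemma recoverable_between_updates:
  assumes control: "piecewise_lipschitz_control R D u"
    and traj: "robot_trajectory R D u x"
    and constraints: "\<And>t. t \<in> {t_init R..} - D \<Longrightarrow> qp_constraints R \<alpha>S (x t) t (u (x t) t)"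
    and \<alpha>S: "ext_class_K \<alpha>S"
    and start: "x (upd_time R k) \<in> recoverable R (upd_time R k)"
    and t: "t \<in> upd_interval R k"
  shows "x t \<in> recoverable R t"
proof -
  define a where "a = upd_time R k"
  have tk: "a \<le> t" and sub: "{a..t} \<subseteq> upd_interval R k" and a: "a \<in> upd_interval R k"
    using t by (auto simp: upd_interval_def a_def)
  have ge: "t_init R \<le> r" if "r \<in> {a..t}" for r
    using upd_interval_ge sub that by blast
  have fin: "finite (D \<inter> {t_init R..t})"
    using control by (simp add: piecewise_lipschitz_control_def)
  have X: "x r \<in> X" if "r \<in> {a..t}" for r
    using traj ge[OF that] by (simp add: robot_trajectory_def)
  have cont: "continuous_on {a..t} x"
    using traj ge by (auto simp: robot_trajectory_def intro: continuous_on_subset)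
  note start' = start[folded a_def, unfolded recoverable_iff[OF a]]
  have K: "\<alpha> r \<le> 0" if "ext_class_K \<alpha>" "r < 0" for \<alpha> :: "real \<Rightarrow> real" and r
    using that by (metis ext_class_K_def less_imp_le strict_mono_less)
  have good: "r \<in> upd_interval R k" "r \<in> {t_init R..} - D" "t_init R < r"
    if "r \<in> {b<..<c} - D \<inter> {t_init R..t}" "a \<le> b" "c \<le> t" for r b c
    using that ge[of r] ge[of a] sub tk by auto
  have eta: "0 \<le> hS R j (backup_flow R k (x r) T) (r + T)"
    if r: "r \<in> {a..t}" and j: "j \<in> {1..num_occ R k}" for r j
  proof (rule barrier_nonneg[OF fin, where a = a and v = "\<lambda>r. hS R j (backup_flow R k (x r) T) (r + T)"
        and \<alpha> = \<alpha>S and v' = "\<lambda>r. c_S R j (x r) r + A_S R j (x r) r \<bullet> u (x r) r"])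
    show "continuous_on {a..r} (\<lambda>r. hS R j (backup_flow R k (x r) T) (r + T))"
      by (rule hS_along_trajectory_continuous[OF continuous_on_subset[OF cont] _ _ j])
        (use r X sub in auto)
    fix p assume p: "p \<in> {a<..<r} - D \<inter> {t_init R..t}"
    note g = good[OF p order_refl]
    have rt: "r \<le> t" using r by simp
    show "((\<lambda>r. hS R j (backup_flow R k (x r) T) (r + T)) has_real_derivative
        c_S R j (x p) p + A_S R j (x p) p \<bullet> u (x p) p) (at p)"
      by (rule eta_has_derivative[where a = a and b = r, OF _ j _ _ refl trajectory_velocity[OF traj g(2)[OF rt]]
            trajectory_derivative[OF traj g(3)[OF rt]]])
        (use p r X sub g(2)[OF rt] in auto)
    show "- \<alpha>S (hS R j (backup_flow R k (x p) T) (p + T)) \<le> c_S R j (x p) p + A_S R j (x p) p \<bullet> u (x p) p"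
      using constraints[OF g(2)[OF rt]] j
      by (auto simp: qp_constraints_def eta_def phi_b_def occ_indices_def upd_index_eq[OF g(1)[OF rt]])
  qed (use r j start' \<alpha>S K in auto)
  have hC: "0 \<le> hC R j (backup_flow R k (x t) s) t s"
    if s: "s \<in> {0..T}" and j: "j \<in> {1..num_occ R k}" for s j
  proof -
    define \<tau> where "\<tau> = t + s"
    define b where "b = max a (\<tau> - T)"
    have b: "a \<le> b" "b \<le> t" "\<And>r. r \<in> {b..t} \<Longrightarrow> \<tau> - r \<in> {0..T}"
      using s tk by (auto simp: b_def \<tau>_def)
    have "0 \<le> hC R j (backup_flow R k (x t) (\<tau> - t)) t (\<tau> - t)"
    proof (rule barrier_nonneg[OF fin b(2), where v = "\<lambda>r. hC R j (backup_flow R k (x r) (\<tau> - r)) r (\<tau> - r)"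
          and \<alpha> = "alpha_C R" and v' = "\<lambda>r. c_C R j (x r) r \<tau> + A_C R j (x r) r \<tau> \<bullet> u (x r) r"])
      show "continuous_on {b..t} (\<lambda>r. hC R j (backup_flow R k (x r) (\<tau> - r)) r (\<tau> - r))"
        by (rule hC_along_trajectory_continuous[OF continuous_on_subset[OF cont] _ _ b(3) j])
          (use b(1) X sub in auto)
      show "0 \<le> hC R j (backup_flow R k (x b) (\<tau> - b)) b (\<tau> - b)"
      proof (cases "b = a")
        case True
        then show ?thesis using start' b(2) b(3)[of b] j by auto
      next
        case False
        then have bT: "\<tau> - b = T" by (auto simp: b_def max_def split: if_splits)
        have bk: "b \<in> upd_interval R k" "b \<in> {a..t}" using b sub by auto
        have "backup_flow R k (x b) T \<in> X"
          using flow_in[OF X[OF bk(2)]] horizon_pos by simp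
        then show ?thesis
          unfolding bT by (rule terminal_margin_nonneg[OF bk(1) j]) (rule eta[OF bk(2) j])
      qed
      fix p assume p: "p \<in> {b<..<t} - D \<inter> {t_init R..t}"
      note g = good[OF p b(1) order_refl]
      show "((\<lambda>r. hC R j (backup_flow R k (x r) (\<tau> - r)) r (\<tau> - r)) has_real_derivative
          c_C R j (x p) p \<tau> + A_C R j (x p) p \<tau> \<bullet> u (x p) p) (at p)"
        by (rule xi_C_has_derivative[where a = b and b = t, OF _ b(3) j _ _ refl
              trajectory_velocity[OF traj g(2)] trajectory_derivative[OF traj g(3)]])
          (use p b(1) X sub g(2) in auto)
      show "- alpha_C R (hC R j (backup_flow R k (x p) (\<tau> - p)) p (\<tau> - p))
          \<le> c_C R j (x p) p \<tau> + A_C R j (x p) p \<tau> \<bullet> u (x p) p"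
        using constraints[OF g(2)] j b(3)[of p] p
        by (auto simp: qp_constraints_def xi_C_def phi_b_def occ_indices_def upd_index_eq[OF g(1)])
    next
      show "alpha_C R r \<le> 0" if "r < 0" for r
        using K[OF _ that] setting by (simp add: ocbf_setting_def)
    qed
    then show ?thesis by (simp add: \<tau>_def)
  qed
  show ?thesis
    unfolding recoverable_iff[OF t] using hC eta tk X by auto
qed

text \<open>The backup input is feasible: with it the state moves along the backup flow, so the gradient
  terms cancel in \<open>c\<^sub>C + A\<^sub>C u\<close>.\<close>

lemma backup_feasible:
  assumes \<alpha>S: "ext_class_K \<alpha>S"
    and terminal: "\<And>q y j. q \<ge> t_init R + T \<Longrightarrow> y \<in> term_set R q \<Longrightarrow>
          j \<in> occ_indices R (q - T) \<Longrightarrow>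
          dq_hS R j y q + grad_hS R j y q \<bullet> f_b R (upd_index R (q - T)) y \<ge> - \<alpha>S (hS R j y q)"
    and margin: "\<And>t j y s. t \<ge> t_init R \<Longrightarrow> j \<in> occ_indices R t \<Longrightarrow> y \<in> X \<Longrightarrow>
          s \<in> {0..T} \<Longrightarrow> dt_hC R j y t s - ds_hC R j y t s \<ge> 0"
    and t: "t \<in> upd_interval R k" and x: "x \<in> recoverable R t"
  shows "qp_constraints R \<alpha>S x t (backup R k x)"
proof -
  note x' = x[unfolded recoverable_iff[OF t]]
  have xX: "x \<in> X" using x' by blast
  have ge: "t_init R \<le> t" by (rule upd_interval_ge[OF t])
  note ind = upd_index_eq[OF t]
  obtain Y :: "real \<Rightarrow> (real, 'n) vec \<Rightarrow>\<^sub>L (real, 'n) vec" where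
    Y: "\<And>s. s \<in> {0..T} \<Longrightarrow> ((\<lambda>z. backup_flow R k z s) has_derivative blinfun_apply (Y s)) (at x within X)"
    "\<And>s. s \<in> {0..T} \<Longrightarrow> Y s (f_b R k x) = f_b R k (backup_flow R k x s)"
    using flow_differentiable[OF xX, of k] by metis
  have vel: "velocity_in X x (f_b R k x)"
    by (rule velocity_in_backup[OF xX])
  have K: "- \<alpha> r \<le> 0" if "ext_class_K \<alpha>" "0 \<le> r" for \<alpha> :: "real \<Rightarrow> real" and r
    using that by (metis ext_class_K_def neg_le_0_iff_le strict_mono_less_eq)
  have T: "T \<in> {0..T}" using horizon_pos by simp
  show ?thesis
    unfolding qp_constraints_def
  proof (intro conjI ballI)
    fix j \<tau> assume j: "j \<in> occ_indices R t" and \<tau>: "\<tau> \<in> {t..t + T}"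
    have s: "\<tau> - t \<in> {0..T}" using \<tau> by auto
    define y where "y = backup_flow R k x (\<tau> - t)"
    have y: "y \<in> X" unfolding y_def by (rule flow_in[OF xX s])
    have "c_C R j x t \<tau> + A_C R j x t \<tau> \<bullet> backup R k x = dt_hC R j y t (\<tau> - t) - ds_hC R j y t (\<tau> - t)"
      using c_C_A_C_eq[OF t Y(1)[OF s] f_b_def vel y_def] Y(2)[OF s] by (simp add: y_def)
    moreover have "0 \<le> xi_C R j x t \<tau>"
      using x' j s by (simp add: xi_C_def phi_b_def ind occ_indices_def)
    moreover have "ext_class_K (alpha_C R)" using setting by (simp add: ocbf_setting_def)
    ultimately show "- alpha_C R (xi_C R j x t \<tau>) \<le> c_C R j x t \<tau> + A_C R j x t \<tau> \<bullet> backup R k x"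
      using margin[OF ge j y s] K by fastforce
  next
    fix j assume j: "j \<in> occ_indices R t"
    define y where "y = backup_flow R k x T"
    have "y \<in> X" unfolding y_def by (rule flow_in[OF xX T])
    then have "y \<in> term_set R (t + T)"
      using x' by (simp add: term_set_def y_def occ_indices_def ind)
    then have "- \<alpha>S (hS R j y (t + T)) \<le> dq_hS R j y (t + T) + grad_hS R j y (t + T) \<bullet> f_b R k y"
      using terminal[of "t + T" y j] ge j by (simp add: ind)
    then show "- \<alpha>S (eta R j x t) \<le> c_S R j x t + A_S R j x t \<bullet> backup R k x"
      using c_S_A_S_eq[OF t Y(1)[OF T] f_b_def vel y_def] Y(2)[OF T]
      by (simp add: eta_def phi_b_def ind y_def)
  qed
qed

end

theorem theorem1:
  fixes R :: "('n::finite, 'm::finite, 'd::finite) ocbf"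
    and x :: "real \<Rightarrow> real^'n"
    and u :: "real^'n \<Rightarrow> real \<Rightarrow> real^'m"
    and D :: "real set"
    and \<alpha>S :: "real \<Rightarrow> real"
  assumes setting: "ocbf_setting R"
    and occ_workspace: "\<And>t. t \<ge> t_init R \<Longrightarrow>
          (\<Union>j\<in>occ_indices R t. occ R j (position R (x t)) t) \<subseteq> workspace R"
    and i_coverage: "\<And>t s j. t \<ge> t_init R \<Longrightarrow> s \<in> {0..horizon R} \<Longrightarrow> j \<in> occ_indices R t \<Longrightarrow>
          occ R j (position R (x t)) t + cball 0 (obs_speed R * s + col_radius R)
            \<subseteq> occ_pred R j t s"
    and i_consistency: "\<And>k j t s \<delta>. j \<in> {1..num_occ R k} \<Longrightarrow> \<delta> \<ge> 0 \<Longrightarrow>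
          t \<in> upd_interval R k \<Longrightarrow> t + \<delta> \<in> upd_interval R k \<Longrightarrow>
          s \<in> {0..horizon R} \<Longrightarrow> s + \<delta> \<in> {0..horizon R} \<Longrightarrow>
          occ_pred R j (t + \<delta>) s \<subseteq> occ_pred R j t (s + \<delta>)"
    and ii_class_K: "ext_class_K \<alpha>S"
    and ii_terminal: "\<And>q y j. q \<ge> t_init R + horizon R \<Longrightarrow> y \<in> term_set R q \<Longrightarrow>
          j \<in> occ_indices R (q - horizon R) \<Longrightarrow>
          dq_hS R j y q + grad_hS R j y q \<bullet> f_b R (upd_index R (q - horizon R)) y
            \<ge> - \<alpha>S (hS R j y q)"
    and iii: "\<And>t j y s. t \<ge> t_init R \<Longrightarrow> j \<in> occ_indices R t \<Longrightarrow> y \<in> state_set R \<Longrightarrow>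
          s \<in> {0..horizon R} \<Longrightarrow> dt_hC R j y t s - ds_hC R j y t s \<ge> 0"
    and iv_backup: "\<And>k. C1_on (state_set R) (backup R k)"
    and iv_hC: "\<And>k j. j \<in> {1..num_occ R k} \<Longrightarrow>
          C1_on (state_set R \<times> upd_interval R k \<times> {0..horizon R}) (\<lambda>(y, t, s). hC R j y t s)"
    and iv_hS: "\<And>k j. j \<in> {1..num_occ R k} \<Longrightarrow>
          C1_on (state_set R \<times> term_interval R k) (\<lambda>(y, q). hS R j y q)"
    and iv_input: "\<And>k y. y \<in> state_set R \<Longrightarrow> backup R k y \<in> input_set R"
    and iv_flow: "\<And>k. is_backup_flow R k"
    and control: "piecewise_lipschitz_control R D u"
    and trajectory: "robot_trajectory R D u x"
    and constraints: "\<And>t. t \<in> {t_init R..} - D \<Longrightarrow> qp_constraints R \<alpha>S (x t) t (u (x t) t)"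
    and initial: "x (t_init R) \<in> recoverable R (t_init R)"
    and updates: "\<And>k. k \<ge> 1 \<Longrightarrow> x (upd_time R k) \<in> recoverable R (upd_time R k)"
  shows "(\<forall>t\<ge>t_init R. x t \<in> recoverable R t \<and>
            (\<forall>j\<in>occ_indices R t. hC R j (x t) t 0 \<ge> 0)) \<and>
         (\<forall>t\<ge>t_init R. qp_feasible R \<alpha>S (x t) t) \<and>
         (\<forall>t\<ge>t_init R. \<forall>j\<in>occ_indices R t.
            position R (x t) \<notin> interior (occ_pred R j t 0) \<and>
            occ R j (position R (x t)) t + cball 0 (col_radius R) \<subseteq> occ_pred R j t 0)"
proof -
  interpret ocbf_model R
    by standard (fact setting iv_backup iv_hC iv_hS iv_flow)+
  have start: "x (upd_time R k) \<in> recoverable R (upd_time R k)" for k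
    using initial updates[of k] by (cases "k = 0") (auto simp: t_init_def)
  have rec: "x t \<in> recoverable R t" if t: "t \<ge> t_init R" for t
  proof -
    obtain k where "t \<in> upd_interval R k" using upd_interval_cover[OF t] .
    from recoverable_between_updates[OF control trajectory constraints ii_class_K start this]
    show ?thesis .
  qed
  have margin: "hC R j (x t) t 0 \<ge> 0" if t: "t \<ge> t_init R" and j: "j \<in> occ_indices R t" for t j
  proof -
    have "hC R j (phi_b R t (x t) 0) t 0 \<ge> 0" "x t \<in> X"
      using rec[OF t] j horizon_pos by (auto simp: recoverable_def)
    then show ?thesis by (simp add: phi_b_def flow_0)
  qed
  have feasible: "qp_feasible R \<alpha>S (x t) t" if t: "t \<ge> t_init R" for t
  proof -
    obtain k where k: "t \<in> upd_interval R k" using upd_interval_cover[OF t] .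
    have "qp_constraints R \<alpha>S (x t) t (backup R k (x t))"
      by (rule backup_feasible[OF ii_class_K ii_terminal iii k rec[OF t]])
    moreover have "backup R k (x t) \<in> input_set R"
      using rec[OF t] by (intro iv_input) (simp add: recoverable_def)
    ultimately show ?thesis unfolding qp_feasible_def by blast
  qed
  have avoid: "position R (x t) \<notin> interior (occ_pred R j t 0)"
    if t: "t \<ge> t_init R" and j: "j \<in> occ_indices R t" for t j
    using setting t j margin[OF t j] rec[OF t] horizon_pos
    unfolding ocbf_setting_def recoverable_def by auto
  have cover: "occ R j (position R (x t)) t + cball 0 (col_radius R) \<subseteq> occ_pred R j t 0"
    if t: "t \<ge> t_init R" and j: "j \<in> occ_indices R t" for t j
    using i_coverage[OF t _ j, of 0] horizon_pos by simp
  show ?thesis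
    using rec margin feasible avoid cover by blast
qed

end
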